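(* Let $\mathbb P$ be a product measure (i.i.d. couplings in $[0,1]$) such that $\mathbb P(J_e>0)=1$. Then, uniformly over $\mathbf n\in S^{d-1}$, $$\lim_{\beta\to\infty}\frac{\tau^q_\beta(\mathbf n)}{\beta}=\mu(\mathbf n).$$
   Context: Fix $d\ge 2$, $q\ge 1$; $\beta\ge 0$. For $x,y\in\mathbb Z^d$ write $x\sim y$ if $\|x-y\|_2=1$; for $\Lambda\subset\mathbb Z^d$ let $E(\Lambda)=\{\{x,y\}:x,y\in\Lambda,\ x\sim y\}$. The couplings $J=(J_e)_{e\in E(\mathbb Z^d)}$ are i.i.d. with values in $[0,1]$ under the product measure $\mathbb P$. Random cluster model: for finite $E\subset E(\mathbb Z^d)$, boundary condition $\pi\in\{0,1\}^{E^c}$ and $\omega\in\{0,1\}^E$, $\Phi^{J,\pi,q}_{E,\beta}(\{\omega\})=\frac1Z\prod_{e\in E}p_e^{\omega_e}(1-p_e)^{1-\omega_e}\,q^{C^\pi_E(\omega)}$ with $p_e=1-e^{-\beta J_e}$, where $C^\pi_E(\omega)$ is the number of clusters of the set of vertices touched by $E$ when connections use the open edges of $\omega$ in $E$ and of $\pi$ outside $E$, and $Z$ is the normalizing constant. The boundary condition $w$ (wired) is $\pi\equiv1$. Geometry: $S^{d-1}$ is the Euclidean unit sphere. For $\mathbf n\in S^{d-1}$, $\mathbb S_{\mathbf n}$ is the set of the $(d-1)$-dimensional unit cubes $\{\sum_{k=1}^{d-1}t_k\mathbf u_k: t_k\in[-\frac12,\frac12]\}$ with $(\mathbf u_1,\dots,\mathbf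 u_{d-1},\mathbf n)$ an orthonormal basis of $\mathbb R^d$. $\mathcal R_{x,L,H}(\mathcal S,\mathbf n)=x+L\mathcal S+[-H,H]\mathbf n$. For such $\mathcal R$, $\hat{\mathcal R}$ is the set of points of $\mathbb Z^d$ in the interior of $\mathcal R$; $\partial\hat{\mathcal R}=\{y\in\hat{\mathcal R}:\exists z\in\mathbb Z^d\setminus\hat{\mathcal R},\ z\sim y\}$; $\partial^+\hat{\mathcal R}=\{y\in\partial\hat{\mathcal R}:(y-x)\cdot\mathbf n\ge0\}$, $\partial^-\hat{\mathcal R}=\{y\in\partial\hat{\mathcal R}:(y-x)\cdot\mathbf n<0\}$. $\Phi^{J,w}_{\mathcal R}$ is $\Phi^{J,w,q}_{E(\hat{\mathcal R}),\beta}$. Surface tension: $\mathcal D_{\mathcal R}$ is the event that no $\omega$-open path in $E(\hat{\mathcal R})$ joins $\partial^+\hat{\mathcal R}$ to $\partial^-\hat{\mathcal R}$, and $\tau^J_{\mathcal R}=-\frac1{L^{d-1}}\log\Phi^{J,w}_{\mathcal R}(\mathcal D_{\mathcal R})$. The quenched surface tension $\tau^q_\beta(\mathbf n)$ is the limit in $\mathbb P$-probability of $\tau^J_{\mathcal R_{0,N,\delta N}(\mathcal S,\mathbf n)}$ as $N\to\infty$ (it exists and does not depend on $\delta>0$, $\mathcal S\in\mathbb S_{\mathbf n}$). Maximal flow: a set $I\subset E(\hat{\mathcal R})$ is an interface for $\mathcal R$ if closing all edges of $I$ disconnects $\partial^+\hat{\mathcal R}$ from $\partial^-\hat{\mathcal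 R}$ in $E(\hat{\mathcal R})$ (i.e. $\{\omega_e=0\ \forall e\in I\}\subset\mathcal D_{\mathcal R}$) and no $I\setminus\{e\}$, $e\in I$, has this property. With $\mathcal I(\mathcal R)$ the set of interfaces, $\mu^J_{\mathcal R}=\frac1{L^{d-1}}\inf_{I\in\mathcal I(\mathcal R)}\sum_{e\in I}J_e$, and $\mu(\mathbf n)\in[0,\infty)$ is the limit in $\mathbb P$-probability of $\mu^J_{\mathcal R_{0,N,\delta N}(\mathcal S,\mathbf n)}$ as $N\to\infty$ (it is known that this limit exists and does not depend on $\delta>0$, $\mathcal S\in\mathbb S_{\mathbf n}$). *)

theory Defs
  imports "HOL-Probability.Probability"
begin

section \<open>The lattice\<close>

text \<open>The dimension \<open>d\<close> is \<open>CARD('d)\<close>; an edge is a two-element set of vertices.\<close>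

type_synonym 'd vertex = "int ^ 'd"
type_synonym 'd edge = "'d vertex set"

definition real_point :: "'d::finite vertex \<Rightarrow> real ^ 'd" where
  "real_point x = (\<chi> i. real_of_int (x $ i))"

definition adjacent :: "'d::finite vertex \<Rightarrow> 'd vertex \<Rightarrow> bool" where
  "adjacent x y \<longleftrightarrow> norm (real_point x - real_point y) = 1"

definition edges :: "'d::finite vertex set \<Rightarrow> 'd edge set" where
  "edges \<Lambda> = {{x, y} | x y. x \<in> \<Lambda> \<and> y \<in> \<Lambda> \<and> adjacent x y}"

definition connection :: "'d::finite edge set \<Rightarrow> ('d vertex \<times> 'd vertex) set" where
  "connection \<omega> = {(x, y). {x, y} \<in> \<omega>}\<^sup>*"

section \<open>The random cluster model\<close>

text \<open>
  A configuration in \<open>{0,1}\<^sup>E\<close> is encoded as its set of open edges, so that the configuration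
  space is \<open>Pow E\<close>; likewise a boundary condition \<open>\<pi>\<close> is a subset of \<open>edges UNIV - E\<close>.
  Connections may use edges of \<open>\<pi>\<close> arbitrarily far from \<open>E\<close>, but only clusters
  meeting the set \<open>\<Union>E\<close> of vertices touched by \<open>E\<close> are counted.
\<close>

definition cluster_count :: "'d::finite edge set \<Rightarrow> 'd edge set \<Rightarrow> 'd edge set \<Rightarrow> nat" where
  "cluster_count E \<pi> \<omega> = card (\<Union>E // connection (\<omega> \<union> \<pi>))"

definition open_prob :: "real \<Rightarrow> ('d::finite edge \<Rightarrow> real) \<Rightarrow> 'd edge \<Rightarrow> real" where
  "open_prob \<beta> J e = 1 - exp (- \<beta> * J e)"

definition rc_weight ::
  "real \<Rightarrow> real \<Rightarrow> ('d::finite edge \<Rightarrow> real) \<Rightarrow> 'd edge set \<Rightarrow> 'd edge set \<Rightarrow> 'd edge set \<Rightarrow> real"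
where
  "rc_weight q \<beta> J E \<pi> \<omega> =
     (\<Prod>e\<in>E. if e \<in> \<omega> then open_prob \<beta> J e else 1 - open_prob \<beta> J e) * q ^ cluster_count E \<pi> \<omega>"

definition rc_partition ::
  "real \<Rightarrow> real \<Rightarrow> ('d::finite edge \<Rightarrow> real) \<Rightarrow> 'd edge set \<Rightarrow> 'd edge set \<Rightarrow> real"
where
  "rc_partition q \<beta> J E \<pi> = (\<Sum>\<omega>\<in>Pow E. rc_weight q \<beta> J E \<pi> \<omega>)"

definition rc_measure ::
  "real \<Rightarrow> real \<Rightarrow> ('d::finite edge \<Rightarrow> real) \<Rightarrow> 'd edge set \<Rightarrow> 'd edge set \<Rightarrow> 'd edge set measure"
where
  "rc_measure q \<beta> J E \<pi> =
     point_measure (Pow E) (\<lambda>\<omega>. ennreal (rc_weight q \<beta> J E \<pi> \<omega> / rc_partition q \<beta> J E \<pi>))"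

definition wired :: "'d::finite edge set \<Rightarrow> 'd edge set" where
  "wired E = edges UNIV - E"

section \<open>Rectangular parallelepipeds\<close>

text \<open>
  The conditions below say that \<open>u 0, \<dots>, u (d-2), \<nu>\<close> are orthonormal; being \<open>d\<close> vectors
  in \<open>\<real>\<^sup>d\<close>, they form a basis.
\<close>

definition unit_cubes :: "real ^ 'd::finite \<Rightarrow> (real ^ 'd) set set" where
  "unit_cubes \<nu> =
     {{\<Sum>k<CARD('d) - 1. t k *\<^sub>R u k | t. \<forall>k<CARD('d) - 1. t k \<in> {- 1/2 .. 1/2}} |
        u :: nat \<Rightarrow> real ^ 'd.
        norm \<nu> = 1 \<and>
        (\<forall>j<CARD('d) - 1. u j \<bullet> \<nu> = 0) \<and>
        (\<forall>j<CARD('d) - 1. \<forall>k<CARD('d) - 1. u j \<bullet> u k = (if j = k then 1 else 0))}"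

definition rectangle ::
  "real ^ 'd::finite \<Rightarrow> real \<Rightarrow> real \<Rightarrow> (real ^ 'd) set \<Rightarrow> real ^ 'd \<Rightarrow> (real ^ 'd) set"
where
  "rectangle x L H S \<nu> = {x + L *\<^sub>R s + h *\<^sub>R \<nu> | s h. s \<in> S \<and> h \<in> {- H .. H}}"

definition lattice_part :: "(real ^ 'd::finite) set \<Rightarrow> 'd vertex set" where
  "lattice_part R = {z. real_point z \<in> interior R}"

definition boundary :: "'d::finite vertex set \<Rightarrow> 'd vertex set" where
  "boundary \<Lambda> = {y \<in> \<Lambda>. \<exists>z. z \<notin> \<Lambda> \<and> adjacent z y}"

definition upper_boundary :: "real ^ 'd::finite \<Rightarrow> real ^ 'd \<Rightarrow> 'd vertex set \<Rightarrow> 'd vertex set" where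
  "upper_boundary x \<nu> \<Lambda> = {y \<in> boundary \<Lambda>. (real_point y - x) \<bullet> \<nu> \<ge> 0}"

definition lower_boundary :: "real ^ 'd::finite \<Rightarrow> real ^ 'd \<Rightarrow> 'd vertex set \<Rightarrow> 'd vertex set" where
  "lower_boundary x \<nu> \<Lambda> = {y \<in> boundary \<Lambda>. (real_point y - x) \<bullet> \<nu> < 0}"

section \<open>Surface tension and maximal flow in a rectangle\<close>

text \<open>\<open>x\<close> is the centre of the rectangle, \<open>\<nu>\<close> its normal and \<open>\<Lambda>\<close> its set of lattice points.\<close>

definition disconnection ::
  "real ^ 'd::finite \<Rightarrow> real ^ 'd \<Rightarrow> 'd vertex set \<Rightarrow> 'd edge set set"
where
  "disconnection x \<nu> \<Lambda> =
     {\<omega> \<in> Pow (edges \<Lambda>).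
        \<not> (\<exists>y\<in>upper_boundary x \<nu> \<Lambda>. \<exists>z\<in>lower_boundary x \<nu> \<Lambda>. (y, z) \<in> connection \<omega>)}"

definition rect_surface_tension ::
  "real \<Rightarrow> real \<Rightarrow> ('d::finite edge \<Rightarrow> real) \<Rightarrow>
     real ^ 'd \<Rightarrow> real \<Rightarrow> real \<Rightarrow> (real ^ 'd) set \<Rightarrow> real ^ 'd \<Rightarrow> real"
where
  "rect_surface_tension q \<beta> J x L H S \<nu> =
     (let \<Lambda> = lattice_part (rectangle x L H S \<nu>); E = edges \<Lambda>
      in - (1 / L ^ (CARD('d) - 1)) *
           ln (measure (rc_measure q \<beta> J E (wired E)) (disconnection x \<nu> \<Lambda>)))"

definition separating ::
  "real ^ 'd::finite \<Rightarrow> real ^ 'd \<Rightarrow> 'd vertex set \<Rightarrow> 'd edge set \<Rightarrow> bool"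
where
  "separating x \<nu> \<Lambda> I \<longleftrightarrow> {\<omega> \<in> Pow (edges \<Lambda>). \<forall>e\<in>I. e \<notin> \<omega>} \<subseteq> disconnection x \<nu> \<Lambda>"

definition interfaces ::
  "real ^ 'd::finite \<Rightarrow> real ^ 'd \<Rightarrow> 'd vertex set \<Rightarrow> 'd edge set set"
where
  "interfaces x \<nu> \<Lambda> =
     {I. I \<subseteq> edges \<Lambda> \<and> separating x \<nu> \<Lambda> I \<and> (\<forall>e\<in>I. \<not> separating x \<nu> \<Lambda> (I - {e}))}"

definition rect_max_flow ::
  "('d::finite edge \<Rightarrow> real) \<Rightarrow>
     real ^ 'd \<Rightarrow> real \<Rightarrow> real \<Rightarrow> (real ^ 'd) set \<Rightarrow> real ^ 'd \<Rightarrow> real"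
where
  "rect_max_flow J x L H S \<nu> =
     (1 / L ^ (CARD('d) - 1)) *
       (INF I \<in> interfaces x \<nu> (lattice_part (rectangle x L H S \<nu>)). \<Sum>e\<in>I. J e)"

section \<open>Limits in probability\<close>

text \<open>\<open>\<rho>\<close> is the law of a single coupling.\<close>

definition couplings :: "real measure \<Rightarrow> ('d::finite edge \<Rightarrow> real) measure" where
  "couplings \<rho> = PiM (edges UNIV) (\<lambda>_. \<rho>)"

definition converges_in_prob :: "'a measure \<Rightarrow> (nat \<Rightarrow> 'a \<Rightarrow> real) \<Rightarrow> real \<Rightarrow> bool" where
  "converges_in_prob M X c \<longleftrightarrow>
     (\<forall>\<epsilon>>0. (\<lambda>N. \<P>(\<omega> in M. \<bar>X N \<omega> - c\<bar> > \<epsilon>)) \<longlonglongrightarrow> 0)"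

definition has_surface_tension ::
  "real measure \<Rightarrow> real \<Rightarrow> real \<Rightarrow> real ^ 'd::finite \<Rightarrow> real \<Rightarrow> bool"
where
  "has_surface_tension \<rho> q \<beta> \<nu> t \<longleftrightarrow>
     (\<forall>\<delta>>0. \<forall>S\<in>unit_cubes \<nu>.
        converges_in_prob (couplings \<rho>)
          (\<lambda>N J. rect_surface_tension q \<beta> J 0 (real N) (\<delta> * real N) S \<nu>) t)"

definition surface_tension :: "real measure \<Rightarrow> real \<Rightarrow> real \<Rightarrow> real ^ 'd::finite \<Rightarrow> real" where
  "surface_tension \<rho> q \<beta> \<nu> = (THE t. has_surface_tension \<rho> q \<beta> \<nu> t)"

definition has_max_flow :: "real measure \<Rightarrow> real ^ 'd::finite \<Rightarrow> real \<Rightarrow> bool" where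
  "has_max_flow \<rho> \<nu> m \<longleftrightarrow>
     (\<forall>\<delta>>0. \<forall>S\<in>unit_cubes \<nu>.
        converges_in_prob (couplings \<rho>)
          (\<lambda>N J. rect_max_flow J 0 (real N) (\<delta> * real N) S \<nu>) m)"

definition max_flow :: "real measure \<Rightarrow> real ^ 'd::finite \<Rightarrow> real" where
  "max_flow \<rho> \<nu> = (THE m. has_max_flow \<rho> \<nu> m)"

end

theory Submission
  imports Defs
begin

text \<open>
  Fix a direction \<open>\<nu>\<close>. By hypothesis both limits may be computed in the rotated cubes of side \<open>N\<close>
  with one axis along \<open>\<nu>\<close> (half-height \<open>N / 2\<close>, any base \<open>S\<close>). Let \<open>h = N\<^sup>d\<^sup>-\<^sup>1\<close>, let \<open>c(J)\<close> be the least
  \<open>J\<close>-weight of an interface in such a cube, so that \<open>\<mu>\<^sub>N = c(J) / h\<close>, and let \<open>\<Phi>(D)\<close> be the wired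
  probability of disconnection, so that \<open>\<tau>\<^sub>N = - ln \<Phi>(D) / h\<close>.

  Upper bound. If all edges of a set \<open>I\<close> are closed, there are at least as many clusters as before, and
  \<open>q \<ge> 1\<close>; hence this event has probability at least \<open>\<Prod>\<^sub>e\<^sub>\<in>\<^sub>I (1 - p\<^sub>e) = exp (- \<beta> \<Sum>\<^sub>e\<^sub>\<in>\<^sub>I J\<^sub>e)\<close>. Taking a minimal
  interface gives \<open>\<tau>\<^sub>N \<le> \<beta> \<mu>\<^sub>N\<close> for every \<open>J\<close> (\<open>disconnection_lower_bound\<close>).

  Lower bound: a Peierls argument. Opening one edge merges at most two clusters, so the event that \<open>I\<close> is
  closed has probability at most \<open>q\<^bsup>|I|\<^esup> exp (- \<beta> \<Sum>\<^sub>e\<^sub>\<in>\<^sub>I J\<^sub>e)\<close>. A sum over all cutsets would carry too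
  much entropy. However, every disconnecting configuration leaves some cutset \<open>I\<close> closed each of whose edges
  is linked, by steps of bounded range inside \<open>I\<close>, to the set \<open>F\<close> of edges that leave the cube through its
  upper boundary (\<open>disconnection_has_rooted_cutset\<close>). In a graph of degree at most \<open>\<Delta>\<close>,
  the rooted sets satisfy \<open>\<Sum>\<^sub>I 2\<^bsup>-(\<Delta>+1)|I|\<^esup> \<le> 2\<^bsup>\<Delta>|F|\<^esup>\<close> (\<open>rooted_sets_entropy\<close>), and \<open>|F|\<close> is
  of order \<open>h\<close> (\<open>lattice_boundary\<close>). For \<open>s \<le> \<beta>\<close>, each cutset satisfies
  \<open>exp (- \<beta> J(I)) \<le> exp (- (\<beta> - s) c(J)) exp (- s J(I))\<close>, whence

  \<open>\<Phi>(D) \<le> exp (- (\<beta> - s) c(J)) \<Sigma>(J)\<close>  with  \<open>\<Sigma>(J) = \<Sum>\<^sub>I q\<^bsup>|I|\<^esup> exp (- s J(I))\<close>.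

  Independence gives \<open>E \<Sigma> = \<Sum>\<^sub>I (q E exp (- s J\<^sub>e))\<^bsup>|I|\<^esup>\<close>. Because \<open>J\<^sub>e > 0\<close> almost surely,
  \<open>E exp (- s J\<^sub>e)\<close> tends to \<open>0\<close> as \<open>s\<close> grows, so some \<open>s\<close>, depending only on the law, on \<open>q\<close> and on
  the dimension, makes \<open>E \<Sigma> \<le> 2\<^bsup>\<Delta>|F|\<^esup>\<close>. By Markov's inequality \<open>\<Sigma> < 2 \<sqdot> 2\<^bsup>\<Delta>|F|\<^esup>\<close> with
  probability at least \<open>1/2\<close>, and on that event \<open>\<tau>\<^sub>N \<ge> (\<beta> - s) \<mu>\<^sub>N - k\<close> with a constant \<open>k\<close>
  (\<open>typical_cut_sum\<close>).

  An event of probability \<open>1/2\<close> suffices: for large \<open>N\<close> it meets the events on which \<open>\<tau>\<^sub>N\<close> and \<open>\<mu>\<^sub>N\<close>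
  are close to their limits in probability. Therefore \<open>(\<beta> - s) \<mu>(\<nu>) - k \<le> \<tau>\<^sub>\<beta>(\<nu>) \<le> \<beta> \<mu>(\<nu>)\<close>, and as \<open>\<mu>\<close> is
  bounded by a constant (\<open>tension_flow_comparison\<close>), dividing by \<open>\<beta>\<close> gives the limit with an error of order
  \<open>1 / \<beta>\<close>, uniformly in \<open>\<nu>\<close>.
\<close>

section \<open>Nearest neighbours in the integer lattice\<close>

lemma adjacent_iff_axis:
  "adjacent x y \<longleftrightarrow> (\<exists>i. y = x + axis i 1 \<or> x = y + axis i 1)"
proof
  assume "adjacent x y"
  then have "(norm (real_point x - real_point y))\<^sup>2 = 1" by (simp add: adjacent_def)
  then have "(\<Sum>i\<in>UNIV. (real_of_int (x $ i) - real_of_int (y $ i))\<^sup>2) = 1"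
    by (simp add: norm_vec_def L2_set_def real_point_def sum_nonneg)
  then have "real_of_int (\<Sum>i\<in>UNIV. (x $ i - y $ i)\<^sup>2) = real_of_int 1" by simp
  then have "(\<Sum>i\<in>UNIV. (x $ i - y $ i)\<^sup>2) = 1" by (simp only: of_int_eq_iff)
  then have "int (\<Sum>i\<in>UNIV. nat ((x $ i - y $ i)\<^sup>2)) = int 1" by simp
  then have "(\<Sum>i\<in>UNIV. nat ((x $ i - y $ i)\<^sup>2)) = Suc 0"
    by (simp only: of_nat_eq_iff One_nat_def)
  then obtain i where i: "nat ((x $ i - y $ i)\<^sup>2) = Suc 0"
    "\<And>j. i \<noteq> j \<Longrightarrow> nat ((x $ j - y $ j)\<^sup>2) = 0"
    unfolding sum_eq_Suc0_iff[OF finite] by auto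
  have eq: "x $ j = y $ j" if "j \<noteq> i" for j
  proof -
    have "(x $ j - y $ j)\<^sup>2 \<le> 0" using i(2)[of j] that by auto
    then show ?thesis by simp
  qed
  have "(x $ i - y $ i)\<^sup>2 = 1" using i(1) by linarith
  then have "y $ i = x $ i + 1 \<or> x $ i = y $ i + 1" by (auto simp: power2_eq_1_iff)
  then have "y = x + axis i 1 \<or> x = y + axis i 1"
    using eq by (auto simp: vec_eq_iff axis_def)
  then show "\<exists>i. y = x + axis i 1 \<or> x = y + axis i 1" ..
next
  have *: "norm (real_point x - real_point (x + axis i 1)) = 1" for x :: "'a vertex" and i
  proof -
    have "real_point x - real_point (x + axis i 1) = - axis i 1"
      by (simp add: real_point_def vec_eq_iff axis_def)
    then show ?thesis by simp
  qed
  assume "\<exists>i. y = x + axis i 1 \<or> x = y + axis i 1"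
  then show "adjacent x y" unfolding adjacent_def using * by (metis norm_minus_commute)
qed

lemma adjacent_sym: "adjacent x y \<Longrightarrow> adjacent y x"
  by (simp add: adjacent_def norm_minus_commute)

lemma adjacent_axis [simp]: "adjacent x (x + axis i 1)"
  by (auto simp: adjacent_iff_axis)

lemma edges_iff: "{x, y} \<in> edges \<Lambda> \<longleftrightarrow> x \<in> \<Lambda> \<and> y \<in> \<Lambda> \<and> adjacent x y"
  by (auto simp: edges_def doubleton_eq_iff adjacent_sym)

definition set_coord :: "'d::finite \<Rightarrow> int \<Rightarrow> int ^ 'd \<Rightarrow> int ^ 'd" where
  "set_coord i k x = (\<chi> j. if j = i then k else x $ j)"

lemma set_coord_nth [simp]: "set_coord i k x $ j = (if j = i then k else x $ j)"
  by (simp add: set_coord_def)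

lemma set_coord_same: "set_coord i (x $ i) x = x"
  by (simp add: vec_eq_iff)

lemma set_coord_plus_axis: "set_coord i (k + 1) x = set_coord i k x + axis i 1"
  by (simp add: vec_eq_iff axis_def)

section \<open>A Poincare lemma modulo two\<close>

text \<open>
  Truth values stand for the field with two elements and \<open>\<noteq>\<close> for its addition. The potential \<open>H\<close> is the parity
  of the signed sum of \<open>\<phi>\<close> from \<open>0\<close> to \<open>k\<close>.
\<close>

lemma antidifference_mod_2:
  fixes \<phi> :: "int \<Rightarrow> bool"
  shows "\<exists>H :: int \<Rightarrow> bool. \<forall>k. \<phi> k \<longleftrightarrow> H k \<noteq> H (k + 1)"
proof -
  define \<psi> :: "int \<Rightarrow> int" where "\<psi> = (\<lambda>k. of_bool (\<phi> k))"
  define H where "H k = (\<Sum>m\<in>{0..<k}. \<psi> m) - (\<Sum>m\<in>{k..<0}. \<psi> m)" for k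
  have "H (k + 1) = H k + \<psi> k" for k
  proof (cases "k \<ge> 0")
    case True
    then have "{0..<k+1} = insert k {0..<k}" "{k..<0} = {}" "{k+1..<0} = {}" by auto
    then show ?thesis by (simp add: H_def)
  next
    case False
    then have "{k..<0} = insert k {k+1..<0}" "{0..<k} = {}" "{0..<k+1} = {}" by auto
    then show ?thesis by (simp add: H_def)
  qed
  then have "\<phi> k \<longleftrightarrow> odd (H k) \<noteq> odd (H (k + 1))" for k by (auto simp: \<psi>_def)
  then have "\<forall>k. \<phi> k \<longleftrightarrow> (odd \<circ> H) k \<noteq> (odd \<circ> H) (k + 1)" by simp
  then show ?thesis by (rule exI[of _ "odd \<circ> H"])
qed

text \<open>
  A 1-cochain \<open>f\<close>, with \<open>f i x\<close> its value on the edge from \<open>x\<close> in direction \<open>i\<close>, is a coboundary as soon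
  as its sum around each plaquette vanishes. The potential is built one direction at a time: once the
  directions in \<open>S\<close> are integrated, the remainder \<open>\<phi>\<close> in a new direction \<open>j\<close> is invariant under shifts in
  \<open>S\<close>, so that integrating it along lines parallel to \<open>j\<close> leaves the directions in \<open>S\<close> untouched.
\<close>

lemma poincare_mod_2:
  fixes f :: "'d::finite \<Rightarrow> int ^ 'd \<Rightarrow> bool"
  assumes closed: "\<And>i j x. (f i x \<noteq> f j (x + axis i 1)) \<longleftrightarrow> (f j x \<noteq> f i (x + axis j 1))"
  obtains g :: "int ^ 'd \<Rightarrow> bool" where "\<And>i x. f i x \<longleftrightarrow> g x \<noteq> g (x + axis i 1)"
proof -
  have "\<exists>g :: int ^ 'd \<Rightarrow> bool. \<forall>i\<in>S. \<forall>x. f i x \<longleftrightarrow> g x \<noteq> g (x + axis i 1)" if "finite S" for S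
    using that
  proof (induction S rule: finite_induct)
    case empty
    show ?case by simp
  next
    case (insert j S)
    from insert.IH obtain g :: "int ^ 'd \<Rightarrow> bool" where "\<forall>i\<in>S. \<forall>x. f i x \<longleftrightarrow> g x \<noteq> g (x + axis i 1)" ..
    then have g: "f i x \<longleftrightarrow> g x \<noteq> g (x + axis i 1)" if "i \<in> S" for i x
      using that by simp
    define \<phi> where "\<phi> x \<longleftrightarrow> (f j x \<noteq> (g x \<noteq> g (x + axis j 1)))" for x
    have inv: "\<phi> (x + axis i 1) \<longleftrightarrow> \<phi> x" if "i \<in> S" for i x
    proof -
      have "g (x + axis i 1 + axis j 1) = g (x + axis j 1 + axis i 1)"
        by (simp add: algebra_simps)
      then show ?thesis
        using closed[of i x j] g[OF that, of x] g[OF that, of "x + axis j 1"] unfolding \<phi>_def by argo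
    qed
    have "\<forall>\<psi>. \<exists>H :: int \<Rightarrow> bool. \<forall>k. \<psi> k \<longleftrightarrow> H k \<noteq> H (k + 1)"
      by (intro allI antidifference_mod_2)
    from choice[OF this] obtain H :: "(int \<Rightarrow> bool) \<Rightarrow> int \<Rightarrow> bool" where
      H: "\<And>\<psi> k. \<psi> k \<longleftrightarrow> H \<psi> k \<noteq> H \<psi> (k + 1)"
      by auto
    define h where "h x = H (\<lambda>k. \<phi> (set_coord j k x)) (x $ j)" for x
    have h_j: "\<phi> x \<longleftrightarrow> h x \<noteq> h (x + axis j 1)" for x
    proof -
      have "set_coord j k (x + axis j 1) = set_coord j k x" for k
        by (simp add: vec_eq_iff axis_def)
      then show ?thesis
        using H[of "\<lambda>k. \<phi> (set_coord j k x)" "x $ j"]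
        by (simp add: h_def set_coord_same axis_def)
    qed
    have h_S: "h (x + axis i 1) = h x" if "i \<in> S" for i x
    proof -
      have "i \<noteq> j" using that insert.hyps by auto
      then have "set_coord j k (x + axis i 1) = set_coord j k x + axis i 1" for k
        by (simp add: vec_eq_iff axis_def)
      then show ?thesis using \<open>i \<noteq> j\<close> inv[OF that] by (simp add: h_def axis_def)
    qed
    show ?case
    proof (intro exI[of _ "\<lambda>x. g x \<noteq> h x"] ballI allI)
      fix i x
      assume "i \<in> insert j S"
      then show "f i x \<longleftrightarrow> (g x \<noteq> h x) \<noteq> (g (x + axis i 1) \<noteq> h (x + axis i 1))"
        using g[of i x] h_S[of i x] h_j[of x] unfolding \<phi>_def by (cases "i = j") auto
    qed
  qed
  from this[OF finite[of UNIV]] obtain g :: "int ^ 'd \<Rightarrow> bool" where "\<forall>i\<in>UNIV. \<forall>x. f i x \<longleftrightarrow> g x \<noteq> g (x + axis i 1)" ..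
  then show ?thesis using that[of g] by simp
qed

section \<open>The complement of a bounded convex lattice set is connected\<close>

lemma invariant_set_coord:
  assumes "\<And>y. y $ i \<in> {min (x $ i) k .. max (x $ i) k} \<Longrightarrow> (\<forall>j. j \<noteq> i \<longrightarrow> y $ j = x $ j) \<Longrightarrow>
     y \<notin> \<Lambda>"
    and g: "\<And>y j. y \<notin> \<Lambda> \<Longrightarrow> y + axis j 1 \<notin> \<Lambda> \<Longrightarrow> g y = g (y + axis j 1)"
  shows "g (set_coord i k x) = g x"
proof -
  have *: "g (set_coord i (k + int n) x) = g (set_coord i k x)"
    if "\<And>m. m \<in> {k .. k + int n} \<Longrightarrow> set_coord i m x \<notin> \<Lambda>" for n k
    using that
  proof (induction n)
    case (Suc n)
    have "g (set_coord i (k + int n + 1) x) = g (set_coord i (k + int n) x)"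
      unfolding set_coord_plus_axis
      by (rule g[symmetric]) (use Suc.prems in \<open>auto simp: set_coord_plus_axis[symmetric]\<close>)
    then show ?case using Suc by (simp add: add_ac)
  qed simp
  have out: "set_coord i m x \<notin> \<Lambda>" if "m \<in> {min (x $ i) k .. max (x $ i) k}" for m
    using that by (intro assms(1)) auto
  show ?thesis
  proof (cases "k \<le> x $ i")
    case True
    then show ?thesis using *[of k "nat (x $ i - k)"] out by (simp add: set_coord_same)
  next
    case False
    then show ?thesis using *[of "x $ i" "nat (k - x $ i)"] out by (simp add: set_coord_same)
  qed
qed

text \<open>
  This is the consequence of convexity that makes the complement of \<open>\<Lambda>\<close> connected: a half-space that contains
  \<open>z\<close> and avoids \<open>\<Lambda>\<close> also contains a coordinate ray from \<open>z\<close>.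
\<close>

definition ray_escapes :: "'d::finite vertex set \<Rightarrow> bool" where
  "ray_escapes \<Lambda> \<longleftrightarrow> (\<forall>z. z \<notin> \<Lambda> \<longrightarrow>
     (\<exists>i. (\<forall>k\<ge>z $ i. set_coord i k z \<notin> \<Lambda>) \<or> (\<forall>k\<le>z $ i. set_coord i k z \<notin> \<Lambda>)))"

text \<open>
  Connectedness of the complement, stated for functions. From a point outside \<open>\<Lambda>\<close> follow the escaping ray until
  one coordinate exceeds the bound \<open>M\<close>. While one coordinate is that large, all the others can be changed freely;
  with a second direction at hand, every such point can be moved to the same corner \<open>c\<close>. In
  dimension one the two ends of the line would remain apart.
\<close>

lemma constant_outside:
  fixes \<Lambda> :: "'d::finite vertex set"
  assumes d: "CARD('d) \<ge> 2"
    and bdd: "\<And>x i. x \<in> \<Lambda> \<Longrightarrow> \<bar>x $ i\<bar> \<le> M"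
    and ray: "ray_escapes \<Lambda>"
    and g: "\<And>y j. y \<notin> \<Lambda> \<Longrightarrow> y + axis j 1 \<notin> \<Lambda> \<Longrightarrow> g y = g (y + axis j 1)"
    and zw: "z \<notin> \<Lambda>" "w \<notin> \<Lambda>"
  shows "g z = g w"
proof -
  note step = invariant_set_coord[where g = g and \<Lambda> = \<Lambda>, OF _ g]
  define c :: "int ^ 'd" where "c = (\<chi> i. \<bar>M\<bar> + 1)"
  have lift: "g (\<chi> j. if j \<in> S then \<bar>M\<bar> + 1 else p $ j) = g p"
    if "finite S" "i \<notin> S" "\<bar>p $ i\<bar> > M" for p i and S :: "'d set"
    using that
  proof (induction S rule: finite_induct)
    case empty
    have "(\<chi> j. p $ j) = p" by (simp add: vec_eq_iff)
    then show ?case by simp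
  next
    case (insert a S)
    let ?p = "\<chi> j. if j \<in> S then \<bar>M\<bar> + 1 else p $ j"
    have "g (set_coord a (\<bar>M\<bar> + 1) ?p) = g ?p"
    proof (rule step)
      fix y :: "'d vertex"
      assume "\<forall>j. j \<noteq> a \<longrightarrow> y $ j = ?p $ j"
      then have "y $ i = p $ i" using insert.prems by auto
      then show "y \<notin> \<Lambda>" using bdd[of y i] insert.prems by auto
    qed
    moreover have "set_coord a (\<bar>M\<bar> + 1) ?p = (\<chi> j. if j \<in> insert a S then \<bar>M\<bar> + 1 else p $ j)"
      by (auto simp: vec_eq_iff)
    ultimately show ?case using insert by simp
  qed
  have far: "g p = g c" if "\<bar>p $ i\<bar> > M" for p i
  proof -
    obtain j where j: "j \<noteq> i"
      using d by (metis (full_types) UNIV_I card_2_iff' card_le_Suc0_iff_eq finite not_less_eq_eq numeral_2_eq_2)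
    define p' where "p' = (\<chi> k. if k \<in> {j} then \<bar>M\<bar> + 1 else p $ k)"
    have "g p' = g p" unfolding p'_def by (rule lift[of _ i]) (use j that in auto)
    moreover have "g (\<chi> k. if k \<in> UNIV - {j} then \<bar>M\<bar> + 1 else p' $ k) = g p'"
      by (rule lift[of _ j]) (auto simp: p'_def)
    moreover have "(\<chi> k. if k \<in> UNIV - {j} then \<bar>M\<bar> + 1 else p' $ k) = c"
      by (auto simp: vec_eq_iff p'_def c_def)
    ultimately show ?thesis by simp
  qed
  have "g z = g c" if z: "z \<notin> \<Lambda>" for z
  proof -
    obtain i where i: "(\<forall>k\<ge>z $ i. set_coord i k z \<notin> \<Lambda>) \<or> (\<forall>k\<le>z $ i. set_coord i k z \<notin> \<Lambda>)"
      using ray z by (auto simp: ray_escapes_def)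
    define k where "k = (if \<forall>k\<ge>z $ i. set_coord i k z \<notin> \<Lambda> then max (z $ i) (\<bar>M\<bar> + 1)
       else min (z $ i) (- \<bar>M\<bar> - 1))"
    have "g (set_coord i k z) = g z"
    proof (rule step)
      fix y :: "'d vertex"
      assume y: "y $ i \<in> {min (z $ i) k..max (z $ i) k}" "\<forall>j. j \<noteq> i \<longrightarrow> y $ j = z $ j"
      then have "y = set_coord i (y $ i) z" by (simp add: vec_eq_iff)
      moreover have "set_coord i (y $ i) z \<notin> \<Lambda>"
      proof (cases "\<forall>k\<ge>z $ i. set_coord i k z \<notin> \<Lambda>")
        case True
        then have "z $ i \<le> y $ i" using y(1) by (auto simp: k_def)
        then show ?thesis using True by blast
      next
        case False
        then have "k = min (z $ i) (- \<bar>M\<bar> - 1)" by (simp only: k_def if_False)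
        then have "y $ i \<le> z $ i" using y(1) by auto
        then show ?thesis using False i by blast
      qed
      ultimately show "y \<notin> \<Lambda>" by simp
    qed
    moreover have "\<bar>set_coord i k z $ i\<bar> > M" by (auto simp: k_def)
    ultimately show ?thesis using far by metis
  qed
  then show ?thesis using zw by metis
qed

section \<open>Rooted cutsets\<close>

definition near :: "'d::finite edge \<Rightarrow> 'd edge \<Rightarrow> bool" where
  "near a b \<longleftrightarrow> (\<forall>x\<in>a \<union> b. \<forall>y\<in>a \<union> b. \<forall>i. \<bar>x $ i - y $ i\<bar> \<le> 1)"

text \<open>
  The edges of \<open>I\<close> that can be reached from the roots \<open>F\<close> by \<open>near\<close> steps which stay in \<open>I\<close>, together
  with the roots.
\<close>

inductive_set reach :: "'d::finite edge set \<Rightarrow> 'd edge set \<Rightarrow> 'd edge set" for F I where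
  base: "e \<in> F \<Longrightarrow> e \<in> reach F I"
| step: "a \<in> reach F I \<Longrightarrow> near a b \<Longrightarrow> b \<in> I \<Longrightarrow> b \<in> reach F I"

definition cut :: "'d::finite vertex set \<Rightarrow> 'd edge set" where
  "cut A = {{x, y} | x y. x \<in> A \<and> y \<notin> A \<and> adjacent x y}"

lemma cut_iff: "{x, y} \<in> cut A \<longleftrightarrow> adjacent x y \<and> (x \<in> A \<longleftrightarrow> y \<notin> A)"
  unfolding cut_def using adjacent_sym by (auto simp: doubleton_eq_iff)

text \<open>
  Proximity of edges only has to link the edges of a common plaquette; the coarser relation \<open>near\<close> does so and
  still has bounded degree.
\<close>

lemma near_plaquette:
  fixes x :: "'d::finite vertex"
  assumes "i \<noteq> j" and P: "P = {x, x + axis i 1, x + axis j 1, x + axis i 1 + axis j 1}"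
    and "a \<subseteq> P" "b \<subseteq> P"
  shows "near a b"
proof -
  have diff: "z $ k - x $ k \<in> {0..1}" if "z \<in> P" for z k
    using that \<open>i \<noteq> j\<close> unfolding P by (auto simp: axis_def)
  then have "\<bar>y $ k - z $ k\<bar> \<le> 1" if "y \<in> P" "z \<in> P" for y z k
    using diff[OF that(1), of k] diff[OF that(2), of k] by auto
  then show ?thesis using assms(3,4) unfolding near_def by blast
qed

text \<open>
  Discarding from the boundary of \<open>A\<close> the pieces that are not linked to the edges leaving \<open>\<Lambda>\<close> yields again the
  boundary of a set. A plaquette meets \<open>cut A\<close> in an even number of edges, and it meets the discarded part \<open>D\<close>
  either in all these edges or in none. So \<open>D\<close> is a closed cochain and by \<open>poincare_mod_2\<close> the coboundary
  of some \<open>g\<close>. No edge outside \<open>\<Lambda>\<close> lies in \<open>D\<close>, hence \<open>g\<close> is constant there, and no edge that leaves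
  \<open>\<Lambda>\<close> lies in \<open>D\<close>, hence \<open>g\<close> has the same value on the boundary of \<open>\<Lambda>\<close>. Toggling \<open>A\<close> where \<open>g\<close>
  differs from that value removes \<open>D\<close> from the cut without changing \<open>A\<close> on the boundary of \<open>\<Lambda>\<close>.
\<close>

lemma rooted_part_is_cut:
  fixes \<Lambda> :: "'d::finite vertex set"
  assumes d: "CARD('d) \<ge> 2"
    and bdd: "\<And>x i. x \<in> \<Lambda> \<Longrightarrow> \<bar>x $ i\<bar> \<le> M"
    and ray: "ray_escapes \<Lambda>"
    and A: "A \<subseteq> \<Lambda>"
    and F: "F = {e \<in> cut A. \<not> e \<subseteq> \<Lambda>}"
  obtains A' where "A' \<subseteq> \<Lambda>" "A' \<inter> boundary \<Lambda> = A \<inter> boundary \<Lambda>" "cut A' = reach F (cut A)"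
proof -
  let ?R = "reach F (cut A)"
  have R_sub: "?R \<subseteq> cut A"
  proof
    fix e
    assume "e \<in> ?R"
    then show "e \<in> cut A" by induction (auto simp: F)
  qed
  have F_sub: "F \<subseteq> ?R" by (auto intro: reach.base)
  define D where "D = cut A - ?R"
  \<comment> \<open>\<open>D\<close> read as a 1-cochain\<close>
  define f where "f i x \<longleftrightarrow> {x, x + axis i 1} \<in> D" for i x
  have closed: "(f i x \<noteq> f j (x + axis i 1)) \<longleftrightarrow> (f j x \<noteq> f i (x + axis j 1))" for i j x
  proof (cases "i = j")
    case False
    let ?P = "{x, x + axis i 1, x + axis j 1, x + axis i 1 + axis j 1}"
    let ?Es = "{{x, x + axis i 1}, {x + axis i 1, x + axis i 1 + axis j 1}, {x, x + axis j 1},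
      {x + axis j 1, x + axis j 1 + axis i 1}}"
    have comm: "x + axis j 1 + axis i 1 = x + axis i 1 + axis j 1" by (simp add: add_ac)
    have sub: "e \<subseteq> ?P" if "e \<in> ?Es" for e using that unfolding comm by auto
    have near: "near a b" if "a \<in> ?Es" "b \<in> ?Es" for a b
      by (rule near_plaquette[OF False refl sub sub]) (fact that)+
    show ?thesis
    proof (cases "?Es \<inter> ?R = {}")
      case True
      then have "e \<in> D \<longleftrightarrow> e \<in> cut A" if "e \<in> ?Es" for e using that by (auto simp: D_def)
      then have "f i x \<longleftrightarrow> {x, x + axis i 1} \<in> cut A" "f j x \<longleftrightarrow> {x, x + axis j 1} \<in> cut A"
        "f j (x + axis i 1) \<longleftrightarrow> {x + axis i 1, x + axis i 1 + axis j 1} \<in> cut A"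
        "f i (x + axis j 1) \<longleftrightarrow> {x + axis j 1, x + axis j 1 + axis i 1} \<in> cut A"
        unfolding f_def by blast+
      moreover have "adjacent (x + axis j 1) (x + axis i 1 + axis j 1)"
        "adjacent (x + axis i 1) (x + axis i 1 + axis j 1)"
        using adjacent_axis[of "x + axis j 1" i] by (simp_all add: comm)
      ultimately show ?thesis unfolding cut_iff comm by auto
    next
      case False
      then obtain a where a: "a \<in> ?Es" "a \<in> ?R" by blast
      have "e \<notin> D" if "e \<in> ?Es" for e
        using reach.step[OF a(2) near[OF a(1) that]] by (auto simp: D_def)
      then show ?thesis unfolding f_def by blast
    qed
  qed simp
  obtain g :: "int ^ 'd \<Rightarrow> bool" where g: "\<And>i x. f i x \<longleftrightarrow> g x \<noteq> g (x + axis i 1)"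
    using poincare_mod_2[of f, OF closed] by blast
  have gD: "{x, y} \<in> D \<longleftrightarrow> g x \<noteq> g y" if "adjacent x y" for x y
    using that g unfolding f_def adjacent_iff_axis by (metis insert_commute)
  have out: "g z = g w" if "z \<notin> \<Lambda>" "w \<notin> \<Lambda>" for z w
  proof (rule constant_outside[OF d bdd ray _ that])
    fix y j
    assume "y \<notin> \<Lambda>" "y + axis j 1 \<notin> \<Lambda>"
    then have "{y, y + axis j 1} \<notin> D" using A by (auto simp: D_def cut_iff)
    then show "g y = g (y + axis j 1)" by (simp add: gD)
  qed
  define g0 where "g0 = g (SOME z. z \<notin> \<Lambda>)"
  have g0: "g z = g0" if "z \<notin> \<Lambda>" for z
    unfolding g0_def by (rule out[OF that]) (rule someI[of "\<lambda>z. z \<notin> \<Lambda>", OF that])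
  define A' where "A' = {x. x \<in> A \<longleftrightarrow> g x = g0}"
  have bd: "g y = g0" if y: "y \<in> boundary \<Lambda>" for y
  proof -
    obtain z where z: "y \<in> \<Lambda>" "z \<notin> \<Lambda>" "adjacent z y" using y by (auto simp: boundary_def)
    then have "{z, y} \<in> cut A \<Longrightarrow> {z, y} \<in> F" by (auto simp: F)
    then have "{z, y} \<notin> D" using F_sub by (auto simp: D_def)
    then show ?thesis using gD[OF z(3)] g0[OF z(2)] by auto
  qed
  have edge: "{x, y} \<in> cut A' \<longleftrightarrow> {x, y} \<in> ?R" if "adjacent x y" for x y
    using gD[OF that] R_sub that by (auto simp: cut_iff A'_def D_def)
  show ?thesis
  proof
    show "A' \<subseteq> \<Lambda>" using g0 A by (auto simp: A'_def)
    show "A' \<inter> boundary \<Lambda> = A \<inter> boundary \<Lambda>" using bd by (auto simp: A'_def)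
    show "cut A' = ?R"
    proof (rule set_eqI)
      fix e
      show "e \<in> cut A' \<longleftrightarrow> e \<in> ?R"
      proof (cases "\<exists>x y. e = {x, y} \<and> adjacent x y")
        case True
        then show ?thesis using edge by blast
      next
        case False
        then have "e \<notin> cut A" "e \<notin> cut A'" by (auto simp: cut_def)
        then show ?thesis using R_sub by blast
      qed
    qed
  qed
qed

lemma connection_closed:
  assumes "(x, y) \<in> connection \<omega>" "x \<in> A"
    and "\<And>u v. {u, v} \<in> \<omega> \<Longrightarrow> u \<in> A \<Longrightarrow> v \<in> A"
  shows "y \<in> A"
  using assms(1,2) unfolding connection_def
  by (induction rule: rtrancl_induct) (use assms(3) in auto)

definition exit_edges :: "real ^ 'd::finite \<Rightarrow> real ^ 'd \<Rightarrow> 'd vertex set \<Rightarrow> 'd edge set" where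
  "exit_edges x \<nu> \<Lambda> = {{y, z} | y z. y \<in> upper_boundary x \<nu> \<Lambda> \<and> z \<notin> \<Lambda> \<and> adjacent y z}"

definition rooted :: "'d::finite edge set \<Rightarrow> 'd edge set \<Rightarrow> bool" where
  "rooted F I \<longleftrightarrow> I \<subseteq> reach F I"

lemma boundary_split:
  "boundary \<Lambda> = upper_boundary x \<nu> \<Lambda> \<union> lower_boundary x \<nu> \<Lambda>"
  "upper_boundary x \<nu> \<Lambda> \<inter> lower_boundary x \<nu> \<Lambda> = {}"
  by (auto simp: upper_boundary_def lower_boundary_def)

text \<open>
  The set \<open>A\<close> of vertices joined to the upper boundary is bounded by closed edges and meets the boundary of \<open>\<Lambda>\<close>
  exactly in its upper part; therefore the edges of \<open>cut A\<close> that leave \<open>\<Lambda>\<close> are the exit edges, whatever \<open>\<omega>\<close>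
  is. Only the part of \<open>cut A\<close> linked to them is kept, and it still separates by \<open>rooted_part_is_cut\<close>. This
  replaces the connectedness of minimal cutsets and works without any regularity of the corners of \<open>\<Lambda>\<close>.
\<close>

lemma disconnection_has_rooted_cutset:
  fixes \<Lambda> :: "'d::finite vertex set"
  assumes d: "CARD('d) \<ge> 2"
    and bdd: "\<And>x i. x \<in> \<Lambda> \<Longrightarrow> \<bar>x $ i\<bar> \<le> M"
    and ray: "ray_escapes \<Lambda>"
    and \<omega>: "\<omega> \<in> disconnection x \<nu> \<Lambda>"
  obtains I where "I \<subseteq> edges \<Lambda>" "rooted (exit_edges x \<nu> \<Lambda>) I" "separating x \<nu> \<Lambda> I" "I \<inter> \<omega> = {}"
proof -
  let ?U = "upper_boundary x \<nu> \<Lambda>" and ?L = "lower_boundary x \<nu> \<Lambda>" and ?F = "exit_edges x \<nu> \<Lambda>"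
  have \<omega>_sub: "\<omega> \<subseteq> edges \<Lambda>" using \<omega> by (simp add: disconnection_def)
  define A where "A = {v. \<exists>y\<in>?U. (y, v) \<in> connection \<omega>}"
  have UA: "?U \<subseteq> A" by (auto simp: A_def connection_def)
  have LA: "?L \<inter> A = {}" using \<omega> by (auto simp: disconnection_def A_def)
  have "v \<in> \<Lambda>" if v: "v \<in> A" for v
  proof -
    obtain y where y: "y \<in> ?U" "(y, v) \<in> connection \<omega>"
      using v unfolding A_def by blast
    show ?thesis using y(2)
      by (rule connection_closed) (use y \<omega>_sub edges_iff in \<open>auto simp: upper_boundary_def boundary_def\<close>)
  qed
  then have A\<Lambda>: "A \<subseteq> \<Lambda>" by blast
  have A_closed: "v \<in> A" if "{u, v} \<in> \<omega>" "u \<in> A" for u v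
    using that unfolding A_def connection_def by (auto intro: rtrancl_into_rtrancl)
  have A_bd: "A \<inter> boundary \<Lambda> = ?U" using UA LA boundary_split[where \<Lambda> = \<Lambda> and x = x and \<nu> = \<nu>]  by blast
  have F: "?F = {e \<in> cut A. \<not> e \<subseteq> \<Lambda>}"
  proof (intro subset_antisym subsetI)
    fix e
    assume "e \<in> ?F"
    then obtain y z where "e = {y, z}" "y \<in> ?U" "z \<notin> \<Lambda>" "adjacent y z"
      by (auto simp: exit_edges_def)
    then show "e \<in> {e \<in> cut A. \<not> e \<subseteq> \<Lambda>}" using UA A\<Lambda> by (auto simp: cut_iff)
  next
    fix e
    assume "e \<in> {e \<in> cut A. \<not> e \<subseteq> \<Lambda>}"
    then obtain y z where e: "e = {y, z}" "y \<in> A" "z \<notin> A" "adjacent y z" "z \<notin> \<Lambda>"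
      using A\<Lambda> by (auto simp: cut_def)
    then have "y \<in> boundary \<Lambda>" using A\<Lambda> adjacent_sym by (auto simp: boundary_def)
    then show "e \<in> ?F" using e A_bd by (auto simp: exit_edges_def)
  qed
  obtain A' where A': "A' \<subseteq> \<Lambda>" "A' \<inter> boundary \<Lambda> = A \<inter> boundary \<Lambda>" "cut A' = reach ?F (cut A)"
    using rooted_part_is_cut[OF d bdd ray A\<Lambda> F] by blast
  define I where "I = cut A' \<inter> edges \<Lambda>"
  have reach_split: "e \<in> ?F \<or> e \<in> edges \<Lambda>" if "e \<in> cut A" for e
    using that by (auto simp: F cut_def edges_def)
  have reach_cut: "e \<in> cut A" if "e \<in> reach ?F (cut A)" for e
    using that by induction (auto simp: F)
  have "e \<in> reach ?F I" if "e \<in> reach ?F (cut A)" for e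
    using that
  proof induction
    case (step a b)
    then have "b \<in> reach ?F (cut A)" by (auto intro: reach.step)
    then show ?case using step reach_split[of b] by (auto simp: I_def A'(3) intro: reach.intros)
  qed (rule reach.base)
  then have "rooted ?F I" by (auto simp: rooted_def I_def A'(3))
  moreover have "separating x \<nu> \<Lambda> I"
    unfolding separating_def disconnection_def
  proof safe
    fix \<eta> y z
    assume \<eta>: "\<eta> \<subseteq> edges \<Lambda>" "\<forall>e\<in>I. e \<notin> \<eta>" and yz: "y \<in> ?U" "z \<in> ?L" "(y, z) \<in> connection \<eta>"
    have "z \<in> A'" using yz(3)
    proof (rule connection_closed)
      show "y \<in> A'" using yz(1) A_bd A'(2) by blast
      fix u v
      assume uv: "{u, v} \<in> \<eta>" "u \<in> A'"
      show "v \<in> A'"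
      proof (rule ccontr)
        assume "v \<notin> A'"
        then have "{u, v} \<in> I" using uv \<eta>(1) edges_iff[of u v \<Lambda>] by (auto simp: I_def cut_iff)
        then show False using uv \<eta>(2) by blast
      qed
    qed
    then show False using yz(2) boundary_split[where \<Lambda> = \<Lambda> and x = x and \<nu> = \<nu>] A_bd A'(2) by blast
  qed
  moreover have "I \<inter> \<omega> = {}"
  proof -
    have "e \<notin> \<omega>" if e: "e \<in> cut A" for e
    proof -
      obtain u v where "e = {u, v}" "u \<in> A" "v \<notin> A" using e by (auto simp: cut_def)
      then show ?thesis using A_closed by blast
    qed
    then show ?thesis using reach_cut by (auto simp: I_def A'(3))
  qed
  ultimately show ?thesis using that[of I] by (auto simp: I_def)
qed

section \<open>Entropy of rooted sets\<close>

lemma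
  fixes B :: "'d::finite \<Rightarrow> int set"
  assumes "\<And>i. finite (B i)"
  shows finite_int_box: "finite {x :: int ^ 'd. \<forall>i. x $ i \<in> B i}"
    and card_int_box: "card {x :: int ^ 'd. \<forall>i. x $ i \<in> B i} = (\<Prod>i\<in>UNIV. card (B i))"
proof -
  have bij: "bij_betw vec_lambda (Pi\<^sub>E UNIV B) {x. \<forall>i. x $ i \<in> B i}"
    by (rule bij_betw_byWitness[where f' = vec_nth]) (auto simp: PiE_def Pi_def)
  show "finite {x :: int ^ 'd. \<forall>i. x $ i \<in> B i}"
    using bij_betw_finite[OF bij] assms by (auto intro: finite_PiE)
  show "card {x :: int ^ 'd. \<forall>i. x $ i \<in> B i} = (\<Prod>i\<in>UNIV. card (B i))"
    using bij_betw_same_card[OF bij] by (simp add: card_PiE)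
qed

lemma near_degree_bound:
  "\<exists>\<Delta>. \<forall>e :: 'd::finite edge. e \<noteq> {} \<longrightarrow> finite {b. near e b} \<and> card {b. near e b} \<le> \<Delta>"
proof -
  define K where "K = {k :: 'd vertex. \<forall>i. k $ i \<in> {-1..1}}"
  have K: "finite K" unfolding K_def by (rule finite_int_box) simp
  have "finite {b. near e b} \<and> card {b. near e b} \<le> 2 ^ card K" if "e \<noteq> {}" for e :: "'d edge"
  proof -
    obtain v where v: "v \<in> e" using \<open>e \<noteq> {}\<close> by blast
    have sub: "{b. near e b} \<subseteq> Pow ((+) v ` K)"
    proof safe
      fix b y
      assume "near e b" "y \<in> b"
      then have "\<bar>y $ i - v $ i\<bar> \<le> 1" for i using v by (auto simp: near_def)
      then have "y - v \<in> K" by (auto simp: K_def abs_le_iff) (metis add.commute diff_le_eq le_diff_eq minus_le_iff uminus_add_conv_diff)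
      then show "y \<in> (+) v ` K" by (intro image_eqI[of _ _ "y - v"]) auto
    qed
    have "card {b. near e b} \<le> card (Pow ((+) v ` K))" using K sub by (intro card_mono) auto
    also have "\<dots> = 2 ^ card K" using K by (simp add: card_Pow card_image)
    finally show ?thesis using finite_subset[OF sub] K by simp
  qed
  then show ?thesis by blast
qed

lemma reach_mono: "I \<subseteq> J \<Longrightarrow> reach F I \<subseteq> reach F J"
proof
  fix e
  assume "I \<subseteq> J" "e \<in> reach F I"
  from this(2) show "e \<in> reach F J" by induction (use \<open>I \<subseteq> J\<close> in \<open>auto intro: reach.intros\<close>)
qed

text \<open>
  Choose a uniformly random subset \<open>\<sigma>\<close> of \<open>V\<close>. For a rooted set \<open>I\<close>, the event that \<open>\<sigma>\<close> contains \<open>I\<close> but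
  no other edge near \<open>I \<union> F\<close> has probability at least \<open>2\<^bsup>-(\<Delta>+1)|I| - \<Delta>|F|\<^esup>\<close>. On this event
  \<open>reach F \<sigma> = I \<union> F\<close>, so that \<open>\<sigma>\<close> determines \<open>I\<close> and the events are disjoint. Their probabilities sum to
  at most one. In the proof, \<open>Fam I\<close> is the set of outcomes in the event of \<open>I\<close>.
\<close>

lemma rooted_sets_entropy:
  fixes V F :: "'d::finite edge set"
  assumes V: "finite V" and F: "finite F" and disj: "V \<inter> F = {}"
    and deg: "\<And>e. e \<in> V \<union> F \<Longrightarrow> finite {b. near e b} \<and> card {b. near e b} \<le> \<Delta>"
  shows "(\<Sum>I | I \<subseteq> V \<and> rooted F I. (1/2) ^ ((\<Delta> + 1) * card I)) \<le> (2 :: real) ^ (\<Delta> * card F)"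
proof -
  let ?FF = "{I. I \<subseteq> V \<and> rooted F I}"
  define N where "N I = (\<Union>e\<in>I \<union> F. {b. near e b})" for I
  define T where "T I = V \<inter> (I \<union> N I)" for I
  define Fam where "Fam I = (\<lambda>\<sigma>. I \<union> \<sigma>) ` Pow (V - T I)" for I
  have recover: "reach F \<sigma> = I \<union> F" if "I \<in> ?FF" "\<sigma> \<in> Fam I" for I \<sigma>
  proof
    have I\<sigma>: "I \<subseteq> \<sigma>" "\<sigma> \<inter> N I \<subseteq> I" using that by (auto simp: Fam_def T_def)
    show "reach F \<sigma> \<subseteq> I \<union> F"
    proof
      fix e
      assume "e \<in> reach F \<sigma>"
      then show "e \<in> I \<union> F"
      proof induction
        case (step a b)
        then have "b \<in> N I" by (auto simp: N_def)
        then show ?case using step I\<sigma> by blast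
      qed simp
    qed
    show "I \<union> F \<subseteq> reach F \<sigma>"
      using that reach_mono[OF I\<sigma>(1), of F] by (auto simp: rooted_def intro: reach.base)
  qed
  have disjoint: "Fam I \<inter> Fam I' = {}" if "I \<in> ?FF" "I' \<in> ?FF" "I \<noteq> I'" for I I'
  proof -
    have "I \<union> F \<noteq> I' \<union> F" using that disj by blast
    then have "\<sigma> \<notin> Fam I'" if "\<sigma> \<in> Fam I" for \<sigma>
      using recover[OF \<open>I \<in> ?FF\<close> that] recover[OF \<open>I' \<in> ?FF\<close>, of \<sigma>] by auto
    then show ?thesis by blast
  qed
  have fin: "finite ?FF" using V by simp
  have finI: "finite I" if "I \<in> ?FF" for I using that V finite_subset by blast
  have card_T: "card (T I) \<le> (\<Delta> + 1) * card I + \<Delta> * card F" if I: "I \<in> ?FF" for I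
  proof -
    have "card (N I) \<le> (\<Sum>e\<in>I \<union> F. card {b. near e b})"
      unfolding N_def by (rule card_UN_le) (use F finI[OF I] in auto)
    also have "\<dots> \<le> card (I \<union> F) * \<Delta>"
      using deg I by (intro sum_bounded_above[where 'a = nat, simplified]) auto
    also have "\<dots> \<le> (card I + card F) * \<Delta>" by (simp add: card_Un_le)
    finally have "card (N I) \<le> (card I + card F) * \<Delta>" .
    moreover have "finite (I \<union> N I)" unfolding N_def using F finI[OF I] I deg by auto
    then have "card (T I) \<le> card (I \<union> N I)" unfolding T_def by (intro card_mono) auto
    moreover have "card (I \<union> N I) \<le> card I + card (N I)" by (rule card_Un_le)
    ultimately show ?thesis by (simp add: algebra_simps)
  qed
  have card_Fam: "real (card (Fam I)) \<ge>
    2 ^ card V * (1/2) ^ (\<Delta> * card F) * (1/2) ^ ((\<Delta> + 1) * card I)" if I: "I \<in> ?FF" for I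
  proof -
    have T: "T I \<subseteq> V" by (auto simp: T_def)
    have "inj_on (\<lambda>\<sigma>. I \<union> \<sigma>) (Pow (V - T I))"
      using I by (auto simp: inj_on_def T_def)
    then have "card (Fam I) = 2 ^ (card V - card (T I))"
      using V T by (simp add: Fam_def card_image card_Pow card_Diff_subset finite_subset)
    then have "real (card (Fam I)) = 2 ^ (card V - card (T I))" by (simp only: of_nat_power of_nat_numeral)
    moreover have "card (T I) \<le> card V" using V T by (rule card_mono)
    then have "(2 :: real) ^ (card V - card (T I)) = 2 ^ card V * (1/2) ^ card (T I)"
      by (simp add: power_diff power_one_over)
    ultimately have "real (card (Fam I)) = 2 ^ card V * (1/2) ^ card (T I)" by simp
    moreover have "(1/2 :: real) ^ card (T I) \<ge> (1/2) ^ (\<Delta> * card F + (\<Delta> + 1) * card I)"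
      using card_T[OF I] by (intro power_decreasing) auto
    ultimately show ?thesis by (simp add: power_add mult.assoc)
  qed
  have "2 ^ card V * (1/2) ^ (\<Delta> * card F) * (\<Sum>I\<in>?FF. (1/2 :: real) ^ ((\<Delta> + 1) * card I))
      \<le> (\<Sum>I\<in>?FF. real (card (Fam I)))"
    unfolding sum_distrib_left by (intro sum_mono card_Fam)
  also have "\<dots> = real (card (\<Union>I\<in>?FF. Fam I))"
    using fin disjoint V by (subst card_UN_disjoint) (auto simp: Fam_def)
  also have "\<dots> \<le> real (card (Pow V))"
    using V by (intro of_nat_mono card_mono) (auto simp: Fam_def T_def)
  also have "\<dots> = 2 ^ card V" using V by (simp add: card_Pow)
  finally have "(1/2) ^ (\<Delta> * card F) * (\<Sum>I\<in>?FF. (1/2 :: real) ^ ((\<Delta> + 1) * card I)) \<le> 1"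
    by (simp add: mult.assoc)
  then show ?thesis by (simp add: power_one_over field_simps)
qed

section \<open>Closing a set of edges in the random cluster model\<close>

lemma connection_refl [simp]: "(x, x) \<in> connection \<omega>"
  by (simp add: connection_def)

lemma connection_trans: "(x, y) \<in> connection \<omega> \<Longrightarrow> (y, z) \<in> connection \<omega> \<Longrightarrow> (x, z) \<in> connection \<omega>"
  unfolding connection_def by (rule rtrancl_trans)

lemma connection_sym: "(x, y) \<in> connection \<omega> \<Longrightarrow> (y, x) \<in> connection \<omega>"
  unfolding connection_def
  by (rule symD[OF sym_rtrancl]) (auto simp: sym_def insert_commute)

lemma connection_mono: "\<omega> \<subseteq> \<omega>' \<Longrightarrow> connection \<omega> \<subseteq> connection \<omega>'"
  unfolding connection_def by (intro rtrancl_mono) auto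

lemma connection_class_eq:
  "connection \<omega> `` {x} = connection \<omega> `` {y} \<longleftrightarrow> (x, y) \<in> connection \<omega>"
  using connection_refl connection_sym connection_trans by (auto simp: set_eq_iff Image_iff) blast+

text \<open>
  A path that needs the new edge can be cut at its first and at its last passage through that edge.
\<close>

lemma connection_insert:
  assumes "(u, v) \<in> connection (insert {x, y} \<omega>)" and "(u, v) \<notin> connection \<omega>"
  shows "\<exists>a\<in>{x, y}. (u, a) \<in> connection \<omega>" "\<exists>a\<in>{x, y}. (v, a) \<in> connection \<omega>"
proof -
  have "(u, v) \<in> connection \<omega> \<or>
    (\<exists>a\<in>{x, y}. (u, a) \<in> connection \<omega>) \<and> (\<exists>a\<in>{x, y}. (v, a) \<in> connection \<omega>)"
    using assms(1) unfolding connection_def[of "insert _ _"]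
  proof (induction rule: rtrancl_induct)
    case (step v w)
    then consider "{v, w} \<in> \<omega>" | "{v, w} = {x, y}" by auto
    then show ?case
    proof cases
      case 1
      then have "(v, w) \<in> connection \<omega>" by (auto simp: connection_def)
      then show ?thesis using step.IH connection_trans connection_sym by blast
    next
      case 2
      then have "v \<in> {x, y}" "w \<in> {x, y}" by auto
      then show ?thesis using step.IH connection_refl by blast
    qed
  qed simp
  then show "\<exists>a\<in>{x, y}. (u, a) \<in> connection \<omega>" "\<exists>a\<in>{x, y}. (v, a) \<in> connection \<omega>"
    using assms(2) by auto
qed

text \<open>
  For the second inequality: two clusters which become one after the insertion are those of \<open>x\<close> and \<open>y\<close>. So the
  clusters other than that of \<open>y\<close> stay distinct.
\<close>

lemma cluster_count_insert:
  assumes fin: "finite (\<Union>E)"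
  shows "cluster_count E \<pi> (insert {x, y} \<omega>) \<le> cluster_count E \<pi> \<omega>"
    and "cluster_count E \<pi> \<omega> \<le> cluster_count E \<pi> (insert {x, y} \<omega>) + 1"
proof -
  define r where "r = connection (\<omega> \<union> \<pi>)"
  define r' where "r' = connection (insert {x, y} \<omega> \<union> \<pi>)"
  have sub: "r \<subseteq> r'" unfolding r_def r'_def by (rule connection_mono) auto
  have cls: "r' `` (r `` {u}) = r' `` {u}" for u
    using sub connection_trans unfolding r_def r'_def by (auto simp: Image_iff) (blast intro: connection_refl)+
  have quot: "U // s = (\<lambda>u. s `` {u}) ` U" for U :: "'a vertex set" and s
    by (auto simp: quotient_def)
  have fin_r: "finite (\<Union>E // r)" using fin by (simp add: quot)
  have img: "(\<lambda>c. r' `` c) ` (\<Union>E // r) = \<Union>E // r'"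
    by (simp add: quot image_image cls)
  show "cluster_count E \<pi> (insert {x, y} \<omega>) \<le> cluster_count E \<pi> \<omega>"
    unfolding cluster_count_def r_def[symmetric] r'_def[symmetric] img[symmetric]
    using fin_r by (rule card_image_le)
  have "inj_on (\<lambda>c. r' `` c) (\<Union>E // r - {r `` {y}})"
  proof (rule inj_onI)
    fix c c'
    assume "c \<in> \<Union>E // r - {r `` {y}}" "c' \<in> \<Union>E // r - {r `` {y}}" and eq: "r' `` c = r' `` c'"
    then obtain u v where uv: "c = r `` {u}" "c' = r `` {v}" "r `` {u} \<noteq> r `` {y}" "r `` {v} \<noteq> r `` {y}"
      unfolding quot by blast
    then have uy: "(u, y) \<notin> r" "(v, y) \<notin> r" by (simp_all only: r_def connection_class_eq not_False_eq_True)
    have "(u, v) \<in> connection (insert {x, y} (\<omega> \<union> \<pi>))"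
      using eq by (simp add: uv cls) (simp add: r'_def connection_class_eq)
    then have "(u, v) \<in> r"
      using connection_insert[of u v x y "\<omega> \<union> \<pi>"] uy connection_trans connection_sym
      unfolding r_def by blast
    then show "c = c'" by (simp add: uv r_def connection_class_eq)
  qed
  then have "card (\<Union>E // r - {r `` {y}}) \<le> card (\<Union>E // r')"
    using img fin_r by (intro card_inj_on_le) (auto simp flip: img)
  moreover have "card (\<Union>E // r) \<le> card (\<Union>E // r - {r `` {y}}) + 1"
    by (metis Suc_eq_plus1 card_Diff_singleton_if diff_le_self le_SucI le_diff_conv order_refl)
  ultimately show "cluster_count E \<pi> \<omega> \<le> cluster_count E \<pi> (insert {x, y} \<omega>) + 1"
    unfolding cluster_count_def r_def[symmetric] r'_def[symmetric] by linarith
qed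

lemma cluster_count_union:
  assumes fin: "finite (\<Union>E)" and "finite \<eta>" "\<eta> \<subseteq> edges UNIV"
  shows "cluster_count E \<pi> (\<omega> \<union> \<eta>) \<le> cluster_count E \<pi> \<omega>"
    and "cluster_count E \<pi> \<omega> \<le> cluster_count E \<pi> (\<omega> \<union> \<eta>) + card \<eta>"
proof -
  have "cluster_count E \<pi> (\<omega> \<union> \<eta>) \<le> cluster_count E \<pi> \<omega> \<and>
    cluster_count E \<pi> \<omega> \<le> cluster_count E \<pi> (\<omega> \<union> \<eta>) + card \<eta>"
    using assms(2,3)
  proof (induction \<eta> rule: finite_induct)
    case (insert e \<eta>)
    then obtain x y where e: "e = {x, y}" by (auto simp: edges_def)
    then show ?case
      using cluster_count_insert[OF fin, where x = x and y = y and \<omega> = "\<omega> \<union> \<eta>" and \<pi> = \<pi>] insert by auto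
  qed simp
  then show "cluster_count E \<pi> (\<omega> \<union> \<eta>) \<le> cluster_count E \<pi> \<omega>"
    and "cluster_count E \<pi> \<omega> \<le> cluster_count E \<pi> (\<omega> \<union> \<eta>) + card \<eta>" by auto
qed

lemma sum_Bernoulli_weights:
  fixes p :: "'e \<Rightarrow> real"
  assumes "finite A"
  shows "(\<Sum>\<eta>\<in>Pow A. \<Prod>e\<in>A. if e \<in> \<eta> then p e else 1 - p e) = 1"
proof -
  have "(\<Sum>\<eta>\<in>Pow A. \<Prod>e\<in>A. if e \<in> \<eta> then p e else 1 - p e) =
    (\<Sum>\<eta>\<in>Pow A. (\<Prod>e\<in>\<eta>. p e) * (\<Prod>e\<in>A - \<eta>. 1 - p e))"
  proof (rule sum.cong)
    fix \<eta>
    assume "\<eta> \<in> Pow A"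
    then have "A \<inter> {e. e \<in> \<eta>} = \<eta>" "A \<inter> - {e. e \<in> \<eta>} = A - \<eta>" by auto
    then show "(\<Prod>e\<in>A. if e \<in> \<eta> then p e else 1 - p e) = (\<Prod>e\<in>\<eta>. p e) * (\<Prod>e\<in>A - \<eta>. 1 - p e)"
      using assms by (simp add: prod.If_cases)
  qed simp
  also have "\<dots> = (\<Prod>e\<in>A. p e + (1 - p e))" using assms by (rule prod_add[symmetric])
  finally show ?thesis by simp
qed

lemma rc_weight_nonneg:
  assumes "q \<ge> 1" "\<beta> \<ge> 0" "\<And>e. e \<in> E \<Longrightarrow> J e \<ge> 0"
  shows "rc_weight q \<beta> J E \<pi> \<omega> \<ge> 0"
  using assms unfolding rc_weight_def open_prob_def by (intro mult_nonneg_nonneg prod_nonneg) auto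

text \<open>
  Split a configuration into its parts \<open>\<omega>\<close> off \<open>I\<close> and \<open>\<eta>\<close> on \<open>I\<close>. Passing from \<open>\<omega> \<union> \<eta>\<close> to \<open>\<omega>\<close> raises the
  cluster count by at least \<open>0\<close> and at most \<open>|I|\<close>, while the Bernoulli weights of the \<open>\<eta>\<close> add up to one. So the
  partition function lies between \<open>q\<^bsup>-|I|\<^esup> K\<close> and \<open>K\<close>, where \<open>K\<close> is the sum over the \<open>\<omega>\<close> alone.
\<close>

lemma rc_closed_weight_bounds:
  fixes E \<pi> I :: "'d::finite edge set"
  assumes q: "q \<ge> 1" and \<beta>: "\<beta> \<ge> 0" and E: "finite E" "E \<subseteq> edges UNIV"
    and J: "\<And>e. e \<in> E \<Longrightarrow> J e \<ge> 0" and I: "I \<subseteq> E"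
  defines "Z \<equiv> rc_partition q \<beta> J E \<pi>"
  defines "W \<equiv> (\<Sum>\<omega>\<in>Pow (E - I). rc_weight q \<beta> J E \<pi> \<omega>)"
  shows "exp (- \<beta> * (\<Sum>e\<in>I. J e)) * Z \<le> W"
    and "W \<le> q ^ card I * exp (- \<beta> * (\<Sum>e\<in>I. J e)) * Z"
    and "Z > 0"
proof -
  define wt where "wt A \<omega> = (\<Prod>e\<in>A. if e \<in> \<omega> then open_prob \<beta> J e else 1 - open_prob \<beta> J e)"
    for A \<omega>
  have finI: "finite I" using I E finite_subset by blast
  have finU: "finite (\<Union>E)" using E by (auto simp: edges_def)
  have p: "open_prob \<beta> J e \<ge> 0" "open_prob \<beta> J e \<le> 1" if "e \<in> E" for e
    using J[OF that] \<beta> by (auto simp: open_prob_def)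
  have wt_nonneg: "wt A \<omega> \<ge> 0" if "A \<subseteq> E" for A \<omega>
    unfolding wt_def using p that by (intro prod_nonneg) auto
  have wt_sum: "(\<Sum>\<eta>\<in>Pow A. wt A \<eta>) = 1" if "finite A" for A
    unfolding wt_def using that by (rule sum_Bernoulli_weights)
  have split: "wt E (\<omega> \<union> \<eta>) = wt (E - A) \<omega> * wt A \<eta>"
    if "\<omega> \<subseteq> E - A" "\<eta> \<subseteq> A" "A \<subseteq> E" for \<omega> \<eta> A
  proof -
    have "wt E (\<omega> \<union> \<eta>) = wt (E - A) (\<omega> \<union> \<eta>) * wt A (\<omega> \<union> \<eta>)"
      unfolding wt_def using E that by (simp add: prod.subset_diff)
    also have "wt (E - A) (\<omega> \<union> \<eta>) = wt (E - A) \<omega>"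
      unfolding wt_def using that by (intro prod.cong) auto
    also have "wt A (\<omega> \<union> \<eta>) = wt A \<eta>"
      unfolding wt_def using that by (intro prod.cong) auto
    finally show ?thesis .
  qed
  have sum_split: "(\<Sum>\<omega>\<in>Pow E. h \<omega>) = (\<Sum>\<omega>\<in>Pow (E - A). \<Sum>\<eta>\<in>Pow A. h (\<omega> \<union> \<eta>))"
    if "A \<subseteq> E" for A and h :: "'d edge set \<Rightarrow> real"
    unfolding sum.cartesian_product
    by (rule sum.reindex_bij_witness[where i = "\<lambda>(a, b). a \<union> b" and j = "\<lambda>\<omega>. (\<omega> - A, \<omega> \<inter> A)"])
       (use that in \<open>auto simp: Un_Diff_Int\<close>)
  define K where "K A = (\<Sum>\<omega>\<in>Pow (E - A). wt (E - A) \<omega> * q ^ cluster_count E \<pi> \<omega>)" for A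
  have weight: "rc_weight q \<beta> J E \<pi> \<omega> = wt E \<omega> * q ^ cluster_count E \<pi> \<omega>" for \<omega>
    by (simp add: rc_weight_def wt_def)
  have Z_eq: "Z = (\<Sum>\<omega>\<in>Pow (E - A). \<Sum>\<eta>\<in>Pow A. wt (E - A) \<omega> * wt A \<eta> * q ^ cluster_count E \<pi> (\<omega> \<union> \<eta>))"
    if "A \<subseteq> E" for A
    unfolding Z_def rc_partition_def sum_split[OF that] weight
    using split[OF _ _ that] by (intro sum.cong) auto
  have count: "cluster_count E \<pi> (\<omega> \<union> \<eta>) \<le> cluster_count E \<pi> \<omega>"
    "cluster_count E \<pi> \<omega> \<le> cluster_count E \<pi> (\<omega> \<union> \<eta>) + card A" if "\<eta> \<subseteq> A" "A \<subseteq> E" for \<omega> \<eta> A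
  proof -
    have fA: "finite A" using that E finite_subset by blast
    have f: "finite \<eta>" "\<eta> \<subseteq> edges UNIV"
      using finite_subset[OF that(1) fA] that E by auto
    have "card \<eta> \<le> card A" using that fA by (intro card_mono) auto
    then show "cluster_count E \<pi> (\<omega> \<union> \<eta>) \<le> cluster_count E \<pi> \<omega>"
      "cluster_count E \<pi> \<omega> \<le> cluster_count E \<pi> (\<omega> \<union> \<eta>) + card A"
      using cluster_count_union[OF finU f, of \<pi> \<omega>] by auto
  qed
  have Z_le: "Z \<le> K A" if A: "A \<subseteq> E" for A
  proof -
    have "Z \<le> (\<Sum>\<omega>\<in>Pow (E - A). \<Sum>\<eta>\<in>Pow A. wt (E - A) \<omega> * wt A \<eta> * q ^ cluster_count E \<pi> \<omega>)"
      unfolding Z_eq[OF A]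
      using A q count(1)[OF _ A] by (intro sum_mono mult_left_mono power_increasing mult_nonneg_nonneg wt_nonneg) auto
    also have "\<dots> = (\<Sum>\<omega>\<in>Pow (E - A). wt (E - A) \<omega> * q ^ cluster_count E \<pi> \<omega> * (\<Sum>\<eta>\<in>Pow A. wt A \<eta>))"
      unfolding sum_distrib_left by (simp add: mult_ac)
    also have "\<dots> = K A" by (simp add: K_def wt_sum[OF finite_subset[OF A E(1)]])
    finally show ?thesis .
  qed
  have K_le: "K A \<le> q ^ card A * Z" if A: "A \<subseteq> E" for A
  proof -
    have "K A = (\<Sum>\<omega>\<in>Pow (E - A). wt (E - A) \<omega> * q ^ cluster_count E \<pi> \<omega> * (\<Sum>\<eta>\<in>Pow A. wt A \<eta>))"
      by (simp add: K_def wt_sum[OF finite_subset[OF A E(1)]])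
    also have "\<dots> = (\<Sum>\<omega>\<in>Pow (E - A). \<Sum>\<eta>\<in>Pow A. wt (E - A) \<omega> * wt A \<eta> * q ^ cluster_count E \<pi> \<omega>)"
      unfolding sum_distrib_left by (simp add: mult_ac)
    also have "\<dots> \<le> (\<Sum>\<omega>\<in>Pow (E - A). \<Sum>\<eta>\<in>Pow A.
        wt (E - A) \<omega> * wt A \<eta> * q ^ (cluster_count E \<pi> (\<omega> \<union> \<eta>) + card A))"
      using A q count(2)[OF _ A] by (intro sum_mono mult_left_mono power_increasing mult_nonneg_nonneg wt_nonneg) auto
    also have "\<dots> = q ^ card A * Z"
      unfolding Z_eq[OF A] by (simp add: sum_distrib_left power_add mult_ac)
    finally show ?thesis .
  qed
  have closed: "wt I {} = exp (- \<beta> * (\<Sum>e\<in>I. J e))"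
    using finI by (simp add: wt_def open_prob_def sum_distrib_left exp_sum flip: sum_negf)
  have "W = wt I {} * K I"
    unfolding W_def K_def sum_distrib_left weight
    using split[OF _ _ I, of _ "{}"] by (intro sum.cong) auto
  then have W: "W = exp (- \<beta> * (\<Sum>e\<in>I. J e)) * K I" by (simp add: closed)
  show "exp (- \<beta> * (\<Sum>e\<in>I. J e)) * Z \<le> W" using Z_le[OF I] by (simp add: W)
  show "W \<le> q ^ card I * exp (- \<beta> * (\<Sum>e\<in>I. J e)) * Z" using K_le[OF I] by (simp add: W mult_ac)
  \<comment> \<open>with every edge closed, \<open>K\<close> consists of a single positive term\<close>
  have "K E > 0" using q by (simp add: K_def wt_def)
  then have "q ^ card E * Z > 0" using K_le[of E] by auto
  then show "Z > 0" using q by (simp add: zero_less_mult_iff)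
qed

lemma rc_measure_eq:
  assumes q: "q \<ge> 1" and \<beta>: "\<beta> \<ge> 0" and E: "finite E" "E \<subseteq> edges UNIV"
    and J: "\<And>e. e \<in> E \<Longrightarrow> J e \<ge> 0" and D: "D \<subseteq> Pow E"
  shows "measure (rc_measure q \<beta> J E \<pi>) D =
    (\<Sum>\<omega>\<in>D. rc_weight q \<beta> J E \<pi> \<omega>) / rc_partition q \<beta> J E \<pi>"
proof -
  have Z: "rc_partition q \<beta> J E \<pi> > 0"
    by (rule rc_closed_weight_bounds(3)[OF q \<beta> E J, where I = "{}"]) auto
  have nn: "rc_weight q \<beta> J E \<pi> \<omega> / rc_partition q \<beta> J E \<pi> \<ge> 0" for \<omega>
    using rc_weight_nonneg[OF q \<beta> J] Z by (intro divide_nonneg_pos) auto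
  have "emeasure (rc_measure q \<beta> J E \<pi>) D =
    (\<Sum>\<omega>\<in>D. ennreal (rc_weight q \<beta> J E \<pi> \<omega> / rc_partition q \<beta> J E \<pi>))"
    unfolding rc_measure_def using E D by (intro emeasure_point_measure_finite) auto
  also have "\<dots> = ennreal (\<Sum>\<omega>\<in>D. rc_weight q \<beta> J E \<pi> \<omega> / rc_partition q \<beta> J E \<pi>)"
    using nn by (simp add: sum_ennreal)
  finally show ?thesis
    using nn by (simp add: measure_def sum_nonneg sum_divide_distrib)
qed

lemma sum_UN_le:
  fixes f :: "'b \<Rightarrow> real"
  assumes "finite A" "\<And>a. a \<in> A \<Longrightarrow> finite (B a)" "\<And>x. f x \<ge> 0"
  shows "sum f (\<Union>a\<in>A. B a) \<le> (\<Sum>a\<in>A. sum f (B a))"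
  using assms(1,2)
proof (induction A rule: finite_induct)
  case (insert a A)
  have "sum f (B a \<union> (\<Union>a\<in>A. B a)) \<le> sum f (B a) + sum f (\<Union>a\<in>A. B a)"
    using insert assms(3) by (subst sum_Un) (auto intro: sum_nonneg)
  then show ?case using insert by auto
qed simp

text \<open>
  A single cutset bounds the disconnection probability from below, and the union bound over a family of cutsets
  bounds it from above.
\<close>

lemma rc_measure_bounds:
  assumes q: "q \<ge> 1" and \<beta>: "\<beta> \<ge> 0" and E: "finite E" "E \<subseteq> edges UNIV"
    and J: "\<And>e. e \<in> E \<Longrightarrow> J e \<ge> 0" and D: "D \<subseteq> Pow E"
  shows rc_measure_ge: "I \<subseteq> E \<Longrightarrow> Pow (E - I) \<subseteq> D \<Longrightarrow>
      measure (rc_measure q \<beta> J E \<pi>) D \<ge> exp (- \<beta> * (\<Sum>e\<in>I. J e))"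
    and rc_measure_le: "FF \<subseteq> Pow E \<Longrightarrow> (\<And>\<omega>. \<omega> \<in> D \<Longrightarrow> \<exists>I\<in>FF. I \<inter> \<omega> = {}) \<Longrightarrow>
      measure (rc_measure q \<beta> J E \<pi>) D \<le> (\<Sum>I\<in>FF. q ^ card I * exp (- \<beta> * (\<Sum>e\<in>I. J e)))"
proof -
  let ?W = "rc_weight q \<beta> J E \<pi>" and ?Z = "rc_partition q \<beta> J E \<pi>"
  note bounds = rc_closed_weight_bounds[OF q \<beta> E J, where \<pi> = \<pi>]
  have Z: "?Z > 0" by (rule bounds(3)[where I = "{}"]) auto
  have nn: "?W \<omega> \<ge> 0" for \<omega> by (rule rc_weight_nonneg[OF q \<beta> J])
  have finD: "finite D" using D E by (meson finite_Pow_iff finite_subset)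
  note eq = rc_measure_eq[OF q \<beta> E J D, where \<pi> = \<pi>]
  {
    assume I: "I \<subseteq> E" "Pow (E - I) \<subseteq> D"
    have "exp (- \<beta> * (\<Sum>e\<in>I. J e)) * ?Z \<le> (\<Sum>\<omega>\<in>Pow (E - I). ?W \<omega>)" by (rule bounds(1)[OF _ I(1)])
    also have "\<dots> \<le> (\<Sum>\<omega>\<in>D. ?W \<omega>)" using I finD nn by (intro sum_mono2) auto
    finally show "measure (rc_measure q \<beta> J E \<pi>) D \<ge> exp (- \<beta> * (\<Sum>e\<in>I. J e))"
      using Z by (simp add: eq field_simps)
  }
  {
    assume FF: "FF \<subseteq> Pow E" "\<And>\<omega>. \<omega> \<in> D \<Longrightarrow> \<exists>I\<in>FF. I \<inter> \<omega> = {}"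
    have finFF: "finite FF" using FF(1) E by (meson finite_Pow_iff finite_subset)
    have "(\<Sum>\<omega>\<in>D. ?W \<omega>) \<le> (\<Sum>\<omega>\<in>(\<Union>I\<in>FF. Pow (E - I)). ?W \<omega>)"
    proof (intro sum_mono2)
      show "D \<subseteq> (\<Union>I\<in>FF. Pow (E - I))"
      proof
        fix \<omega>
        assume "\<omega> \<in> D"
        then show "\<omega> \<in> (\<Union>I\<in>FF. Pow (E - I))" using FF(2)[of \<omega>] D by auto
      qed
    qed (use E finFF nn in auto)
    also have "\<dots> \<le> (\<Sum>I\<in>FF. \<Sum>\<omega>\<in>Pow (E - I). ?W \<omega>)"
      using finFF E nn by (intro sum_UN_le) auto
    also have "\<dots> \<le> (\<Sum>I\<in>FF. q ^ card I * exp (- \<beta> * (\<Sum>e\<in>I. J e)) * ?Z)"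
      using FF(1) by (intro sum_mono bounds(2)) auto
    finally show "measure (rc_measure q \<beta> J E \<pi>) D \<le> (\<Sum>I\<in>FF. q ^ card I * exp (- \<beta> * (\<Sum>e\<in>I. J e)))"
      using Z by (simp add: eq field_simps sum_distrib_left sum_distrib_right)
  }
qed

section \<open>Lattice points of rotated cubes\<close>

lemma unit_cubes_nonempty:
  fixes \<nu> :: "real ^ 'd::finite"
  assumes "norm \<nu> = 1"
  shows "unit_cubes \<nu> \<noteq> {}"
proof -
  have "\<nu> \<noteq> 0" using assms by auto
  then obtain B where B: "\<nu> \<in> B" "pairwise orthogonal B" "\<And>x. x \<in> B \<Longrightarrow> norm x = 1"
    "card B = CARD('d)" "finite B"
    using vector_in_orthonormal_basis[of \<nu>] assms
    by (metis DIM_cart DIM_real independent_imp_finite mult.right_neutral)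
  have "card (B - {\<nu>}) = CARD('d) - 1" using B by simp
  then obtain u where u: "bij_betw u {..<CARD('d) - 1} (B - {\<nu>})"
    using B(5) by (metis bij_betw_from_nat_into_finite finite_Diff)
  have in_B: "u j \<in> B - {\<nu>}" if "j < CARD('d) - 1" for j
    using u that by (auto simp: bij_betw_def)
  have "u j \<bullet> \<nu> = 0" if "j < CARD('d) - 1" for j
    using B(1,2) in_B[OF that] by (auto simp: pairwise_def orthogonal_def)
  moreover have "u j \<bullet> u k = (if j = k then 1 else 0)"
    if "j < CARD('d) - 1" "k < CARD('d) - 1" for j k
  proof (cases "j = k")
    case True
    then show ?thesis using B(3) in_B[OF that(1)] by (simp add: norm_eq_1)
  next
    case False
    then have "u j \<noteq> u k" using u that by (auto simp: bij_betw_def inj_on_def)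
    then show ?thesis using B(2) in_B that False by (auto simp: pairwise_def orthogonal_def)
  qed
  ultimately show ?thesis using assms unfolding unit_cubes_def by blast
qed

text \<open>
  With half-height \<open>L / 2\<close> the rectangle is a cube, symmetric in the members of an orthonormal basis \<open>W\<close> that does
  not depend on \<open>L\<close>; all its facets can then be treated alike.
\<close>

lemma interior_rectangle:
  fixes \<nu> :: "real ^ 'd::finite"
  assumes S: "S \<in> unit_cubes \<nu>"
  shows "\<exists>W. finite W \<and> card W = CARD('d) \<and> (\<forall>w\<in>W. norm w = 1) \<and>
    (\<forall>x. (\<Sum>w\<in>W. (x \<bullet> w) *\<^sub>R w) = x) \<and>
    (\<forall>L>0. interior (rectangle 0 L (1/2 * L) S \<nu>) = {x. \<forall>w\<in>W. \<bar>x \<bullet> w\<bar> < L / 2})"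
proof -
  let ?n = "CARD('d) - 1"
  obtain u where S_eq: "S = {\<Sum>k<?n. t k *\<^sub>R u k | t. \<forall>k<?n. t k \<in> {- 1/2 .. 1/2}}"
    and \<nu>: "norm \<nu> = 1"
    and u\<nu>: "\<And>j. j < ?n \<Longrightarrow> u j \<bullet> \<nu> = 0"
    and uu: "\<And>j k. j < ?n \<Longrightarrow> k < ?n \<Longrightarrow> u j \<bullet> u k = (if j = k then 1 else 0)"
    using S unfolding unit_cubes_def by auto
  define W where "W = insert \<nu> (u ` {..<?n})"
  have \<nu>\<nu>: "\<nu> \<bullet> \<nu> = 1" using \<nu> by (simp add: norm_eq_1)
  have inj: "inj_on u {..<?n}"
  proof (rule inj_onI)
    fix j k
    assume "j \<in> {..<?n}" "k \<in> {..<?n}" "u j = u k"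
    then show "j = k" using uu[of j j] uu[of j k] by (auto split: if_splits)
  qed
  have notin: "\<nu> \<notin> u ` {..<?n}" using u\<nu> \<nu>\<nu> by auto
  have fin: "finite W" by (simp add: W_def)
  have card: "card W = CARD('d)"
    using inj notin by (simp add: W_def card_image)
  have norm: "norm w = 1" if "w \<in> W" for w
    using that \<nu> uu by (auto simp: W_def norm_eq_1)
  have orth: "pairwise orthogonal W"
  proof (rule pairwiseI)
    have uw: "orthogonal (u j) w" if "j < ?n" "w \<in> W" "u j \<noteq> w" for j w
      using that(2,3) u\<nu>[OF that(1)] uu[OF that(1)] unfolding W_def orthogonal_def
      by (metis imageE insertE lessThan_iff)
    fix v w
    assume vw: "v \<in> W" "w \<in> W" "v \<noteq> w"
    then consider j where "j < ?n" "v = u j" | j where "j < ?n" "w = u j" by (auto simp: W_def)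
    then show "orthogonal v w"
    proof cases
      case 1
      then show ?thesis using uw vw by simp
    next
      case 2
      then show ?thesis using uw[of j v] vw by (simp add: orthogonal_commute)
    qed
  qed
  have indep: "independent W"
    using orth norm[of 0] by (intro pairwise_orthogonal_independent) auto
  have "span W = UNIV"
    using indep card_ge_dim_independent[of W UNIV] fin card by (auto simp: dim_UNIV)
  then have expand: "(\<Sum>w\<in>W. (x \<bullet> w) *\<^sub>R w) = x" for x
    using orth norm fin by (intro orthonormal_basis_expand) auto
  have interior: "interior (rectangle 0 L (1/2 * L) S \<nu>) = {x. \<forall>w\<in>W. \<bar>x \<bullet> w\<bar> < L / 2}" if L: "L > 0" for L
  proof -
    have R: "rectangle 0 L (1/2 * L) S \<nu> = {x. \<forall>w\<in>W. \<bar>x \<bullet> w\<bar> \<le> L / 2}"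
    proof (intro subset_antisym subsetI)
      fix x
      assume x: "x \<in> rectangle 0 L (1/2 * L) S \<nu>"
      obtain t h where x: "x = L *\<^sub>R (\<Sum>k<?n. t k *\<^sub>R u k) + h *\<^sub>R \<nu>" and h: "\<bar>h\<bar> \<le> L / 2"
        and t: "\<And>k. k < ?n \<Longrightarrow> \<bar>t k\<bar> \<le> 1/2"
      proof -
        obtain s h where *: "x = 0 + L *\<^sub>R s + h *\<^sub>R \<nu>" "s \<in> S" "h \<in> {- (1/2 * L)..1/2 * L}"
          using x unfolding rectangle_def by blast
        obtain t where t: "s = (\<Sum>k<?n. t k *\<^sub>R u k)" "\<forall>k<?n. t k \<in> {- 1/2..1/2}"
          using *(2) unfolding S_eq by blast
        have "\<bar>t k\<bar> \<le> 1/2" if "k < ?n" for k using t(2) that by (simp add: abs_le_iff) (smt (verit) field_sum_of_halves)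
        moreover have "\<bar>h\<bar> \<le> L / 2" unfolding abs_le_iff using *(3) by auto
        ultimately show ?thesis using that[of t h] * t by simp
      qed
      have "x \<bullet> \<nu> = h" using u\<nu> \<nu>\<nu> by (simp add: x inner_simps inner_sum_left)
      moreover have "\<bar>x \<bullet> u j\<bar> \<le> L / 2" if "j < ?n" for j
      proof -
        have "(\<Sum>k<?n. t k * (u k \<bullet> u j)) = (\<Sum>k<?n. if k = j then t k else 0)"
          using uu that by (intro sum.cong) auto
        also have "\<dots> = t j" using that by simp
        finally have "x \<bullet> u j = L * t j"
          using u\<nu>[OF that] by (simp add: x inner_simps inner_sum_left inner_commute[of \<nu>])
        then show ?thesis using t[OF that] L by (simp add: abs_mult)
      qed
      ultimately show "x \<in> {x. \<forall>w\<in>W. \<bar>x \<bullet> w\<bar> \<le> L / 2}" using h by (auto simp: W_def)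
    next
      fix x
      assume x: "x \<in> {x. \<forall>w\<in>W. \<bar>x \<bullet> w\<bar> \<le> L / 2}"
      have "x = (\<Sum>w\<in>W. (x \<bullet> w) *\<^sub>R w)" by (simp add: expand)
      also have "\<dots> = (x \<bullet> \<nu>) *\<^sub>R \<nu> + (\<Sum>k<?n. (x \<bullet> u k) *\<^sub>R u k)"
        unfolding W_def using notin inj by (simp add: sum.reindex)
      also have "(\<Sum>k<?n. (x \<bullet> u k) *\<^sub>R u k) = L *\<^sub>R (\<Sum>k<?n. ((x \<bullet> u k) / L) *\<^sub>R u k)"
        using L by (simp add: scaleR_right.sum)
      finally have "x = 0 + L *\<^sub>R (\<Sum>k<?n. ((x \<bullet> u k) / L) *\<^sub>R u k) + (x \<bullet> \<nu>) *\<^sub>R \<nu>"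
        unfolding add_0 by (subst add.commute)
      moreover have "(x \<bullet> u k) / L \<in> {- 1/2..1/2}" if "k < ?n" for k
      proof -
        have "\<bar>x \<bullet> u k\<bar> \<le> L / 2" using x that by (auto simp: W_def)
        then have "- (L / 2) \<le> x \<bullet> u k" "x \<bullet> u k \<le> L / 2" by linarith+
        then show ?thesis using L by (simp add: field_simps)
      qed
      then have "(\<Sum>k<?n. ((x \<bullet> u k) / L) *\<^sub>R u k) \<in> S"
        unfolding S_eq by (intro CollectI exI[of _ "\<lambda>k. (x \<bullet> u k) / L"] conjI refl allI impI)
      moreover have "x \<bullet> \<nu> \<in> {- (1/2 * L)..1/2 * L}" using x by (auto simp: W_def abs_le_iff)
      ultimately show "x \<in> rectangle 0 L (1/2 * L) S \<nu>" unfolding rectangle_def by blast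
    qed
    show ?thesis unfolding R
    proof (intro subset_antisym)
      show "interior {x. \<forall>w\<in>W. \<bar>x \<bullet> w\<bar> \<le> L / 2} \<subseteq> {x. \<forall>w\<in>W. \<bar>x \<bullet> w\<bar> < L / 2}"
      proof safe
        fix x w
        assume x: "x \<in> interior {x. \<forall>w\<in>W. \<bar>x \<bullet> w\<bar> \<le> L / 2}" and w: "w \<in> W"
        have w0: "w \<noteq> 0" using norm[OF w] by auto
        have "x \<in> interior {x. w \<bullet> x \<le> L / 2}" "x \<in> interior {x. (- w) \<bullet> x \<le> L / 2}"
          by (rule subsetD[OF interior_mono x]; use w in \<open>force simp: inner_commute abs_le_iff\<close>)+
        then have "w \<bullet> x < L / 2" "(- w) \<bullet> x < L / 2"
          using w0 interior_halfspace_le[of w] interior_halfspace_le[of "- w"]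
          by (simp_all only: mem_Collect_eq neg_equal_0_iff_equal simp_thms)
        then show "\<bar>x \<bullet> w\<bar> < L / 2" unfolding abs_less_iff by (simp add: inner_commute)
      qed
      have "open {x. \<forall>w\<in>W. \<bar>x \<bullet> w\<bar> < L / 2}"
        using fin unfolding Collect_ball_eq
        by (intro open_INT ballI open_Collect_less continuous_intros)
      then show "{x. \<forall>w\<in>W. \<bar>x \<bullet> w\<bar> < L / 2} \<subseteq> interior {x. \<forall>w\<in>W. \<bar>x \<bullet> w\<bar> \<le> L / 2}"
        by (intro interior_maximal) auto
    qed
  qed
  show ?thesis using fin card norm expand interior by (intro exI[of _ W]) simp
qed

text \<open>
  Some coordinate \<open>i\<close> of the unit vector \<open>v\<close> is at least \<open>1 / d\<close> in absolute value. So two points of the slab that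
  agree off \<open>i\<close> differ in coordinate \<open>i\<close> by at most \<open>d\<close>, and reducing that coordinate modulo \<open>d + 1\<close> is
  injective on the slab.
\<close>

lemma card_lattice_slab:
  fixes v :: "real ^ 'd::finite" and M :: int
  assumes v: "norm v = 1" and M: "M \<ge> 0"
  shows "finite {y :: 'd vertex. (\<forall>i. \<bar>y $ i\<bar> \<le> M) \<and> a - 1 \<le> v \<bullet> real_point y \<and> v \<bullet> real_point y \<le> a}"
    (is "finite ?Y")
    and "card {y :: 'd vertex. (\<forall>i. \<bar>y $ i\<bar> \<le> M) \<and> a - 1 \<le> v \<bullet> real_point y \<and> v \<bullet> real_point y \<le> a}
      \<le> (CARD('d) + 1) * nat (2 * M + 1) ^ (CARD('d) - 1)"
proof -
  let ?d = "CARD('d)"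
  \<comment> \<open>the sum of the absolute coordinates is at least the Euclidean norm\<close>
  have "\<exists>i. \<bar>v $ i\<bar> \<ge> 1 / ?d"
  proof (rule ccontr)
    assume "\<not> ?thesis"
    then have "(\<Sum>i\<in>UNIV. \<bar>v $ i\<bar>) < (\<Sum>i\<in>(UNIV :: 'd set). 1 / ?d)"
      by (intro sum_strict_mono) (auto simp: not_le)
    then show False using norm_le_l1_cart[of v] v by simp
  qed
  then obtain i where i: "\<bar>v $ i\<bar> \<ge> 1 / ?d" ..
  define B where "B j = (if j = i then {0..int ?d} else {-M..M})" for j
  have box: "finite {x :: 'd vertex. \<forall>j. x $ j \<in> B j}"
    by (rule finite_int_box) (auto simp: B_def)
  have box_card: "card {x :: 'd vertex. \<forall>j. x $ j \<in> B j} = (?d + 1) * nat (2 * M + 1) ^ (?d - 1)"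
  proof -
    have "card {x :: 'd vertex. \<forall>j. x $ j \<in> B j} = (\<Prod>j\<in>UNIV. card (B j))"
      by (rule card_int_box) (auto simp: B_def)
    also have "\<dots> = card (B i) * (\<Prod>j\<in>UNIV - {i}. card (B j))" by (rule prod.remove) auto
    also have "(\<Prod>j\<in>UNIV - {i}. card (B j)) = (\<Prod>j\<in>UNIV - {i}. nat (2 * M + 1))"
      by (intro prod.cong) (auto simp: B_def)
    finally show ?thesis by (simp add: B_def nat_add_distrib)
  qed
  let ?\<phi> = "\<lambda>y :: 'd vertex. set_coord i (y $ i mod (int ?d + 1)) y"
  have sub: "?\<phi> ` ?Y \<subseteq> {x. \<forall>j. x $ j \<in> B j}"
  proof safe
    fix y :: "'d vertex" and j
    assume "\<forall>i. \<bar>y $ i\<bar> \<le> M"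
    then have "\<bar>y $ j\<bar> \<le> M" ..
    moreover have "y $ i mod (int ?d + 1) < int ?d + 1" by (rule pos_mod_bound) simp
    ultimately show "?\<phi> y $ j \<in> B j" by (auto simp: B_def abs_le_iff)
  qed
  have inj: "inj_on ?\<phi> ?Y"
  proof (rule inj_onI)
    fix y z
    assume y: "y \<in> ?Y" and z: "z \<in> ?Y" and eq: "?\<phi> y = ?\<phi> z"
    have other: "y $ j = z $ j" if "j \<noteq> i" for j
      using that arg_cong[OF eq, of "\<lambda>x. x $ j"] by simp
    have mods: "y $ i mod (int ?d + 1) = z $ i mod (int ?d + 1)"
      using arg_cong[OF eq, of "\<lambda>x. x $ i"] by simp
    have "v \<bullet> real_point y - v \<bullet> real_point z = (\<Sum>j\<in>UNIV. v $ j * (real_of_int (y $ j) - real_of_int (z $ j)))"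
      by (simp add: inner_vec_def real_point_def algebra_simps sum_subtractf)
    also have "\<dots> = v $ i * (real_of_int (y $ i) - real_of_int (z $ i)) +
       (\<Sum>j\<in>UNIV - {i}. v $ j * (real_of_int (y $ j) - real_of_int (z $ j)))"
      by (rule sum.remove) auto
    also have "(\<Sum>j\<in>UNIV - {i}. v $ j * (real_of_int (y $ j) - real_of_int (z $ j))) = 0"
      using other by (intro sum.neutral) auto
    finally have "\<bar>v $ i\<bar> * \<bar>real_of_int (y $ i) - real_of_int (z $ i)\<bar> \<le> 1"
      using y z by (auto simp: abs_mult[symmetric])
    moreover have "(1 / ?d) * \<bar>real_of_int (y $ i) - real_of_int (z $ i)\<bar> \<le>
       \<bar>v $ i\<bar> * \<bar>real_of_int (y $ i) - real_of_int (z $ i)\<bar>"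
      by (intro mult_right_mono i) auto
    ultimately have "(1 / ?d) * \<bar>real_of_int (y $ i) - real_of_int (z $ i)\<bar> \<le> 1" by linarith
    then have "\<bar>real_of_int (y $ i) - real_of_int (z $ i)\<bar> \<le> ?d"
      by (simp add: field_simps)
    then have "\<bar>y $ i - z $ i\<bar> < int ?d + 1" by linarith
    moreover have "int ?d + 1 dvd y $ i - z $ i" using mods by (simp add: mod_eq_dvd_iff)
    ultimately have "y $ i = z $ i" using dvd_imp_le_int[of "y $ i - z $ i" "int ?d + 1"] by auto
    then show "y = z" using other by (auto simp: vec_eq_iff) metis
  qed
  show "finite ?Y" using inj_on_finite[OF inj sub box] .
  show "card ?Y \<le> (?d + 1) * nat (2 * M + 1) ^ (?d - 1)"
    using card_inj_on_le[OF inj sub box] by (simp add: box_card)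
qed

lemma real_point_set_coord:
  "v \<bullet> real_point (set_coord i k z) = v \<bullet> real_point z + v $ i * (real_of_int k - real_of_int (z $ i))"
proof -
  have "v \<bullet> real_point (set_coord i k z) = v $ i * real_of_int k + (\<Sum>j\<in>UNIV - {i}. v $ j * real_of_int (z $ j))"
    by (simp add: inner_vec_def real_point_def sum.remove[of UNIV i])
  moreover have "v \<bullet> real_point z = v $ i * real_of_int (z $ i) + (\<Sum>j\<in>UNIV - {i}. v $ j * real_of_int (z $ j))"
    by (simp add: inner_vec_def real_point_def sum.remove[of UNIV i])
  ultimately show ?thesis by (simp add: algebra_simps)
qed

text \<open>
  A point outside the open cube violates one of \<open>2 d\<close> linear inequalities; this provides the escaping ray. A boundary
  point has a neighbour that violates one of them and hence lies within distance one of a facet, in a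
  slab as in \<open>card_lattice_slab\<close>. The constant in the last bound does not depend on \<open>\<nu>\<close>, which is where the
  uniformity in the direction originates.
\<close>

lemma rectangle_lattice:
  fixes \<nu> :: "real ^ 'd::finite" and L :: real
  assumes S: "S \<in> unit_cubes \<nu>" and L: "L \<ge> 1"
  defines "\<Lambda> \<equiv> lattice_part (rectangle 0 L (1/2 * L) S \<nu>)"
  shows lattice_bounded: "x \<in> \<Lambda> \<Longrightarrow> \<bar>x $ i\<bar> \<le> \<lfloor>CARD('d) * L / 2\<rfloor>"
    and lattice_finite: "finite \<Lambda>"
    and lattice_ray_escapes: "ray_escapes \<Lambda>"
    and lattice_boundary: "real (card (boundary \<Lambda>)) \<le> 2 * real (CARD('d)) * (real (CARD('d)) + 1) ^ CARD('d) * L ^ (CARD('d) - 1)"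
proof -
  let ?d = "CARD('d)" and ?M = "\<lfloor>CARD('d) * L / 2\<rfloor>"
  from interior_rectangle[OF S] obtain W :: "(real ^ 'd) set" where W': "finite W \<and> card W = ?d \<and>
    (\<forall>w\<in>W. norm w = 1) \<and> (\<forall>x. (\<Sum>w\<in>W. (x \<bullet> w) *\<^sub>R w) = x) \<and>
    (\<forall>L>0. interior (rectangle 0 L (1/2 * L) S \<nu>) = {x. \<forall>w\<in>W. \<bar>x \<bullet> w\<bar> < L / 2})" ..
  then have W: "finite W" "card W = ?d" "\<And>w. w \<in> W \<Longrightarrow> norm w = 1"
    "\<And>x. (\<Sum>w\<in>W. (x \<bullet> w) *\<^sub>R w) = x"
    and interior: "interior (rectangle 0 L (1/2 * L) S \<nu>) = {x. \<forall>w\<in>W. \<bar>x \<bullet> w\<bar> < L / 2}"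
    using L by auto
  define V where "V = W \<union> uminus ` W"
  have V: "finite V" "card V \<le> 2 * ?d" "\<And>v. v \<in> V \<Longrightarrow> norm v = 1"
    using W(1,3) card_Un_le[of W "uminus ` W"] card_image_le[of W uminus] W(2) by (auto simp: V_def)
  have \<Lambda>: "\<Lambda> = {z. \<forall>v\<in>V. v \<bullet> real_point z < L / 2}"
    unfolding \<Lambda>_def lattice_part_def interior V_def ball_Un abs_less_iff
    by (auto simp: inner_commute)
  show bounded: "\<bar>x $ i\<bar> \<le> ?M" if "x \<in> \<Lambda>" for x i
  proof -
    have "\<bar>real_of_int (x $ i)\<bar> \<le> norm (real_point x)"
      using component_le_norm_cart[of "real_point x" i] by (simp add: real_point_def)
    also have "\<dots> = norm (\<Sum>w\<in>W. (real_point x \<bullet> w) *\<^sub>R w)" by (simp add: W(4))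
    also have "\<dots> \<le> (\<Sum>w\<in>W. norm ((real_point x \<bullet> w) *\<^sub>R w))" by (rule norm_sum)
    also have "\<dots> \<le> (\<Sum>w\<in>W. L / 2)"
      using that W(3) unfolding \<Lambda>_def lattice_part_def interior
      by (intro sum_mono) (auto intro: less_imp_le)
    also have "\<dots> = ?d * L / 2" by (simp add: W(2))
    finally show ?thesis by (simp add: le_floor_iff)
  qed
  have "\<Lambda> \<subseteq> {x. \<forall>i. x $ i \<in> {-?M..?M}}" using bounded by (auto simp: abs_le_iff) (metis minus_le_iff)
  then show "finite \<Lambda>" by (rule finite_subset) (rule finite_int_box, simp)
  show "ray_escapes \<Lambda>"
    unfolding ray_escapes_def
  proof (intro allI impI)
    fix z
    assume "z \<notin> \<Lambda>"
    then obtain v where v: "v \<in> V" "v \<bullet> real_point z \<ge> L / 2" by (auto simp: \<Lambda> not_less)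
    then have "v \<noteq> 0" using V(3)[of v] by auto
    then obtain i where i: "v $ i \<noteq> 0" by (auto simp: vec_eq_iff)
    have out: "set_coord i k z \<notin> \<Lambda>" if "v $ i * (real_of_int k - real_of_int (z $ i)) \<ge> 0" for k
      using v that by (auto simp: \<Lambda> real_point_set_coord not_less intro!: bexI[of _ v])
    show "\<exists>i. (\<forall>k\<ge>z $ i. set_coord i k z \<notin> \<Lambda>) \<or> (\<forall>k\<le>z $ i. set_coord i k z \<notin> \<Lambda>)"
    proof (intro exI[of _ i])
      show "(\<forall>k\<ge>z $ i. set_coord i k z \<notin> \<Lambda>) \<or> (\<forall>k\<le>z $ i. set_coord i k z \<notin> \<Lambda>)"
        using i by (cases "v $ i > 0") (auto intro!: out simp: zero_le_mult_iff)
    qed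
  qed
  show "real (card (boundary \<Lambda>)) \<le> 2 * real ?d * (real ?d + 1) ^ ?d * L ^ (?d - 1)"
  proof -
    define Y where "Y v = {y :: 'd vertex. (\<forall>i. \<bar>y $ i\<bar> \<le> ?M) \<and> L / 2 - 1 \<le> v \<bullet> real_point y \<and>
      v \<bullet> real_point y \<le> L / 2}" for v :: "real ^ 'd"
    have M: "?M \<ge> 0" using L by simp
    have Y: "finite (Y v)" "card (Y v) \<le> (?d + 1) * nat (2 * ?M + 1) ^ (?d - 1)" if "v \<in> V" for v
      unfolding Y_def by (rule card_lattice_slab[OF V(3)[OF that] M])+
    have "boundary \<Lambda> \<subseteq> (\<Union>v\<in>V. Y v)"
    proof
      fix y
      assume "y \<in> boundary \<Lambda>"
      then obtain z where yz: "y \<in> \<Lambda>" "z \<notin> \<Lambda>" "adjacent z y" by (auto simp: boundary_def)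
      then obtain v where v: "v \<in> V" "v \<bullet> real_point z \<ge> L / 2" by (auto simp: \<Lambda> not_less)
      have "v \<bullet> (real_point z - real_point y) \<le> norm v * norm (real_point z - real_point y)"
        by (rule norm_cauchy_schwarz)
      also have "\<dots> = 1" using V(3)[OF v(1)] yz(3) by (simp add: adjacent_def)
      finally have "v \<bullet> real_point y \<ge> L / 2 - 1" using v(2) by (simp add: inner_diff_right)
      moreover have "v \<bullet> real_point y \<le> L / 2" using yz(1) v(1) by (auto simp: \<Lambda>)
      ultimately show "y \<in> (\<Union>v\<in>V. Y v)" using v(1) bounded[OF yz(1)] by (auto simp: Y_def)
    qed
    then have "card (boundary \<Lambda>) \<le> card (\<Union>v\<in>V. Y v)" using V(1) Y by (intro card_mono) auto
    also have "\<dots> \<le> (\<Sum>v\<in>V. card (Y v))" using V(1) by (rule card_UN_le)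
    also have "\<dots> \<le> card V * ((?d + 1) * nat (2 * ?M + 1) ^ (?d - 1))"
      using Y(2) by (intro sum_bounded_above[where 'a = nat, simplified]) auto
    also have "\<dots> \<le> 2 * ?d * ((?d + 1) * nat (2 * ?M + 1) ^ (?d - 1))"
      using V(2) by (intro mult_right_mono) auto
    finally have "real (card (boundary \<Lambda>)) \<le> real (2 * ?d * ((?d + 1) * nat (2 * ?M + 1) ^ (?d - 1)))"
      by (rule of_nat_mono)
    also have "\<dots> = 2 * real ?d * ((real ?d + 1) * real (nat (2 * ?M + 1)) ^ (?d - 1))" by (simp add: distrib_right)
    also have "\<dots> \<le> 2 * real ?d * ((real ?d + 1) * ((real ?d + 1) * L) ^ (?d - 1))"
    proof (intro mult_left_mono power_mono)
      have "real (nat (2 * ?M + 1)) = 2 * real_of_int ?M + 1" using M by simp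
      also have "\<dots> \<le> ?d * L + 1" using of_int_floor_le[of "?d * L / 2"] by linarith
      also have "\<dots> \<le> (real ?d + 1) * L" using L by (simp add: algebra_simps)
      finally show "real (nat (2 * ?M + 1)) \<le> (real ?d + 1) * L" .
    qed auto
    also have "\<dots> = 2 * real ?d * (real ?d + 1) ^ ?d * L ^ (?d - 1)"
    proof -
      have "(real ?d + 1) * (real ?d + 1) ^ (?d - 1) = (real ?d + 1) ^ ?d"
        by (simp add: power_eq_if)
      then show ?thesis by (simp add: power_mult_distrib mult_ac)
    qed
    finally show ?thesis .
  qed
qed

section \<open>Minimal cuts and the disconnection probability\<close>

lemma adjacent_coord: "adjacent x y \<Longrightarrow> \<bar>x $ i - y $ i\<bar> \<le> 1"
  by (auto simp: adjacent_iff_axis axis_def)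

lemma edges_touching:
  fixes X :: "'d::finite vertex set"
  assumes deg: "\<And>e :: 'd edge. e \<noteq> {} \<Longrightarrow> finite {b. near e b} \<and> card {b. near e b} \<le> \<Delta>"
    and X: "finite X" and T: "T \<subseteq> edges UNIV" "\<And>e. e \<in> T \<Longrightarrow> e \<inter> X \<noteq> {}"
  shows "finite T" "card T \<le> \<Delta> * card X"
proof -
  have sub: "T \<subseteq> (\<Union>y\<in>X. {b. near {y} b})"
  proof
    fix e
    assume e: "e \<in> T"
    then obtain u v where uv: "e = {u, v}" "adjacent u v" using T(1) by (auto simp: edges_def)
    obtain y where y: "y \<in> e" "y \<in> X" using T(2)[OF e] by blast
    have "near {y} e" using y uv adjacent_coord[OF uv(2)] adjacent_coord[OF adjacent_sym[OF uv(2)]]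
      by (auto simp: near_def)
    then show "e \<in> (\<Union>y\<in>X. {b. near {y} b})" using y by blast
  qed
  have fin: "finite (\<Union>y\<in>X. {b. near {y} b})" using X deg by auto
  then show "finite T" using sub finite_subset by blast
  have "card T \<le> card (\<Union>y\<in>X. {b. near {y} b})" by (rule card_mono[OF fin sub])
  also have "\<dots> \<le> (\<Sum>y\<in>X. card {b. near {y} b})" using X by (rule card_UN_le)
  also have "\<dots> \<le> card X * \<Delta>"
    using deg by (intro sum_bounded_above[where 'a = nat, simplified]) auto
  finally show "card T \<le> \<Delta> * card X" by (simp add: mult.commute)
qed

lemma finite_edges: "finite \<Lambda> \<Longrightarrow> finite (edges \<Lambda>)"
  by (rule finite_subset[of _ "Pow \<Lambda>"]) (auto simp: edges_def)

lemma edges_subset_UNIV: "edges \<Lambda> \<subseteq> edges UNIV"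
  by (auto simp: edges_def)

lemma finite_interfaces: "finite \<Lambda> \<Longrightarrow> finite (interfaces x \<nu> \<Lambda>)"
  by (rule finite_subset[of _ "Pow (edges \<Lambda>)"]) (auto simp: interfaces_def finite_edges)

lemma interface_below_separating:
  assumes fin: "finite (edges \<Lambda>)" and I: "I \<subseteq> edges \<Lambda>" "separating x \<nu> \<Lambda> I"
  shows "\<exists>I'\<in>interfaces x \<nu> \<Lambda>. I' \<subseteq> I"
proof -
  let ?A = "{I'. I' \<subseteq> I \<and> separating x \<nu> \<Lambda> I'}"
  have "finite ?A" using finite_subset[OF I(1) fin] by simp
  moreover have "I \<in> ?A" using I by simp
  ultimately obtain m where m: "m \<in> ?A" "m \<subseteq> I" "\<forall>b\<in>?A. b \<subseteq> m \<longrightarrow> m = b"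
    using finite_has_minimal2[of ?A I] by blast
  have "\<not> separating x \<nu> \<Lambda> (m - {e})" if "e \<in> m" for e
  proof
    assume "separating x \<nu> \<Lambda> (m - {e})"
    then have "m - {e} \<in> ?A" using m(1) by auto
    with m(3) have "m - {e} \<subseteq> m \<longrightarrow> m = m - {e}" by (rule bspec)
    then show False using that by blast
  qed
  then have "m \<in> interfaces x \<nu> \<Lambda>" using m I by (auto simp: interfaces_def)
  then show ?thesis using m by blast
qed

text \<open>
  Isolating the whole upper boundary is a crude cut, whose size gives an upper bound on the flow.
\<close>

lemma separating_upper_star:
  "separating x \<nu> \<Lambda> {e \<in> edges \<Lambda>. e \<inter> upper_boundary x \<nu> \<Lambda> \<noteq> {}}"
  unfolding separating_def disconnection_def
proof safe
  fix \<omega> y z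
  assume \<omega>: "\<omega> \<subseteq> edges \<Lambda>" "\<forall>e\<in>{e \<in> edges \<Lambda>. e \<inter> upper_boundary x \<nu> \<Lambda> \<noteq> {}}. e \<notin> \<omega>"
    and yz: "y \<in> upper_boundary x \<nu> \<Lambda>" "z \<in> lower_boundary x \<nu> \<Lambda>" "(y, z) \<in> connection \<omega>"
  have "z \<in> {y}" using yz(3)
    by (rule connection_closed) (use \<omega> yz(1) in auto)
  then show False using yz by (auto simp: upper_boundary_def lower_boundary_def)
qed

text \<open>
  The flow \<open>rect_max_flow\<close> without its normalisation, for an arbitrary vertex set.
\<close>

definition min_cut :: "('d::finite edge \<Rightarrow> real) \<Rightarrow> real ^ 'd \<Rightarrow> real ^ 'd \<Rightarrow> 'd vertex set \<Rightarrow> real" where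
  "min_cut J x \<nu> \<Lambda> = (INF I \<in> interfaces x \<nu> \<Lambda>. \<Sum>e\<in>I. J e)"

context
  fixes \<Lambda> :: "'d::finite vertex set" and J :: "'d edge \<Rightarrow> real" and x \<nu> :: "real ^ 'd"
  assumes fin: "finite \<Lambda>" and J: "\<And>e. e \<in> edges \<Lambda> \<Longrightarrow> J e \<ge> 0"
begin

lemma interfaces_nonempty: "interfaces x \<nu> \<Lambda> \<noteq> {}"
  using interface_below_separating[OF finite_edges[OF fin] _ separating_upper_star] by blast

lemma min_cut_le:
  assumes "I \<subseteq> edges \<Lambda>" "separating x \<nu> \<Lambda> I"
  shows "min_cut J x \<nu> \<Lambda> \<le> (\<Sum>e\<in>I. J e)"
proof -
  obtain I' where I': "I' \<in> interfaces x \<nu> \<Lambda>" "I' \<subseteq> I"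
    using interface_below_separating[OF finite_edges[OF fin] assms] by blast
  have "min_cut J x \<nu> \<Lambda> \<le> (\<Sum>e\<in>I'. J e)"
    unfolding min_cut_def using finite_interfaces[OF fin] I'(1) by (intro cINF_lower bdd_below_finite) auto
  also have "\<dots> \<le> (\<Sum>e\<in>I. J e)"
    using assms(1) I'(2) J finite_subset[OF assms(1) finite_edges[OF fin]] by (intro sum_mono2) auto
  finally show ?thesis .
qed

lemma min_cut_attained:
  obtains I where "I \<subseteq> edges \<Lambda>" "separating x \<nu> \<Lambda> I" "min_cut J x \<nu> \<Lambda> = (\<Sum>e\<in>I. J e)"
proof -
  let ?A = "(\<lambda>I. \<Sum>e\<in>I. J e) ` interfaces x \<nu> \<Lambda>"
  have "Inf ?A = Min ?A" "Min ?A \<in> ?A"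
    using finite_interfaces[OF fin] interfaces_nonempty by (auto intro!: cInf_eq_Min Min_in)
  then obtain I where "I \<in> interfaces x \<nu> \<Lambda>" "min_cut J x \<nu> \<Lambda> = (\<Sum>e\<in>I. J e)"
    unfolding min_cut_def by auto
  then show ?thesis using that by (auto simp: interfaces_def)
qed

lemma disconnection_lower_bound:
  assumes q: "q \<ge> 1" and \<beta>: "\<beta> \<ge> 0"
  shows "exp (- \<beta> * min_cut J x \<nu> \<Lambda>) \<le>
    measure (rc_measure q \<beta> J (edges \<Lambda>) \<pi>) (disconnection x \<nu> \<Lambda>)"
proof -
  obtain I where I: "I \<subseteq> edges \<Lambda>" "separating x \<nu> \<Lambda> I" "min_cut J x \<nu> \<Lambda> = (\<Sum>e\<in>I. J e)"
    by (rule min_cut_attained)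
  show ?thesis unfolding I(3)
  proof (rule rc_measure_ge[OF q \<beta> finite_edges[OF fin] edges_subset_UNIV J _ I(1)])
    show "Pow (edges \<Lambda> - I) \<subseteq> disconnection x \<nu> \<Lambda>"
      using I(2) unfolding separating_def by blast
  qed (auto simp: disconnection_def)
qed

text \<open>
  The Peierls estimate. The part \<open>exp (- (\<beta> - s) J(I))\<close> of the weight of each cutset is bounded by that of the
  minimal cut, and the part \<open>exp (- s J(I))\<close>, which does not involve \<open>\<beta>\<close>, is kept to beat the entropy. The sum may
  then be extended to rooted sets that do not separate, which makes its expectation computable.
\<close>

lemma disconnection_upper_bound:
  assumes d: "CARD('d) \<ge> 2"
    and bdd: "\<And>y i. y \<in> \<Lambda> \<Longrightarrow> \<bar>y $ i\<bar> \<le> M" and ray: "ray_escapes \<Lambda>"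
    and q: "q \<ge> 1" and s: "s \<ge> 0" "s \<le> \<beta>"
  shows "measure (rc_measure q \<beta> J (edges \<Lambda>) \<pi>) (disconnection x \<nu> \<Lambda>) \<le>
    exp (- (\<beta> - s) * min_cut J x \<nu> \<Lambda>) *
      (\<Sum>I | I \<subseteq> edges \<Lambda> \<and> rooted (exit_edges x \<nu> \<Lambda>) I. q ^ card I * exp (- s * (\<Sum>e\<in>I. J e)))"
proof -
  let ?E = "edges \<Lambda>"
  let ?FF = "{I. I \<subseteq> ?E \<and> rooted (exit_edges x \<nu> \<Lambda>) I}"
  let ?FS = "{I \<in> ?FF. separating x \<nu> \<Lambda> I}"
  have \<beta>: "\<beta> \<ge> 0" using s by simp
  have finE: "finite ?E" by (rule finite_edges[OF fin])
  have "measure (rc_measure q \<beta> J ?E \<pi>) (disconnection x \<nu> \<Lambda>) \<le>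
      (\<Sum>I\<in>?FS. q ^ card I * exp (- \<beta> * (\<Sum>e\<in>I. J e)))"
  proof (rule rc_measure_le[OF q \<beta> finE edges_subset_UNIV J])
    fix \<omega>
    assume "\<omega> \<in> disconnection x \<nu> \<Lambda>"
    from disconnection_has_rooted_cutset[OF d bdd ray this]
    obtain I where "I \<subseteq> ?E" "rooted (exit_edges x \<nu> \<Lambda>) I" "separating x \<nu> \<Lambda> I" "I \<inter> \<omega> = {}" .
    then show "\<exists>I\<in>?FS. I \<inter> \<omega> = {}" by blast
  qed (auto simp: disconnection_def)
  also have "\<dots> \<le> (\<Sum>I\<in>?FS. exp (- (\<beta> - s) * min_cut J x \<nu> \<Lambda>) * (q ^ card I * exp (- s * (\<Sum>e\<in>I. J e))))"
  proof (intro sum_mono)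
    fix I
    assume I: "I \<in> ?FS"
    have "exp (- \<beta> * (\<Sum>e\<in>I. J e)) = exp (- (\<beta> - s) * (\<Sum>e\<in>I. J e)) * exp (- s * (\<Sum>e\<in>I. J e))"
      by (simp add: algebra_simps flip: exp_add)
    also have "\<dots> \<le> exp (- (\<beta> - s) * min_cut J x \<nu> \<Lambda>) * exp (- s * (\<Sum>e\<in>I. J e))"
    proof -
      have "(\<beta> - s) * min_cut J x \<nu> \<Lambda> \<le> (\<beta> - s) * (\<Sum>e\<in>I. J e)"
        using min_cut_le[of I] I s by (intro mult_left_mono) auto
      then have "- (\<beta> - s) * (\<Sum>e\<in>I. J e) \<le> - (\<beta> - s) * min_cut J x \<nu> \<Lambda>"
        by (simp only: mult_minus_left neg_le_iff_le)
      then show ?thesis by (intro mult_right_mono) (simp_all only: exp_le_cancel_iff exp_ge_zero)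
    qed
    finally have "q ^ card I * exp (- \<beta> * (\<Sum>e\<in>I. J e)) \<le>
      q ^ card I * (exp (- (\<beta> - s) * min_cut J x \<nu> \<Lambda>) * exp (- s * (\<Sum>e\<in>I. J e)))"
      using q by (intro mult_left_mono) auto
    then show "q ^ card I * exp (- \<beta> * (\<Sum>e\<in>I. J e)) \<le>
        exp (- (\<beta> - s) * min_cut J x \<nu> \<Lambda>) * (q ^ card I * exp (- s * (\<Sum>e\<in>I. J e)))"
      by (simp only: mult.left_commute)
  qed
  also have "\<dots> \<le> (\<Sum>I\<in>?FF. exp (- (\<beta> - s) * min_cut J x \<nu> \<Lambda>) * (q ^ card I * exp (- s * (\<Sum>e\<in>I. J e))))"
    using finE q by (intro sum_mono2) auto
  finally show ?thesis by (simp only: sum_distrib_left)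
qed

end

section \<open>Independent couplings\<close>

context
  fixes \<rho> :: "real measure"
  assumes law: "prob_space \<rho>" "sets \<rho> = sets (restrict_space borel {0..1})"
begin

lemma space_law: "space \<rho> = {0..1}"
  using sets_eq_imp_space_eq[OF law(2)] by (simp add: space_restrict_space)

lemma prob_space_couplings: "prob_space (couplings \<rho> :: ('d::finite edge \<Rightarrow> real) measure)"
  unfolding couplings_def by (intro prob_space_PiM law(1))

lemma coupling_in_unit:
  "J \<in> space (couplings \<rho>) \<Longrightarrow> e \<in> edges UNIV \<Longrightarrow> J e \<in> {0..1}"
  by (auto simp: couplings_def space_PiM space_law PiE_iff)

lemma measurable_law: "f \<in> borel_measurable borel \<Longrightarrow> f \<in> borel_measurable \<rho>"
  for f :: "real \<Rightarrow> real"
  by (subst measurable_cong_sets[OF law(2) refl]) (rule measurable_restrict_space1)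

lemma measurable_coupling:
  fixes e :: "'d::finite edge"
  assumes "e \<in> edges UNIV"
  shows "(\<lambda>J. J e) \<in> borel_measurable (couplings \<rho>)"
proof -
  have "(\<lambda>J. J e) \<in> measurable (couplings \<rho>) \<rho>"
    unfolding couplings_def using assms by (rule measurable_component_singleton)
  from measurable_compose[OF this measurable_law[of "\<lambda>x. x"]] show ?thesis by simp
qed

lemma measurable_min_cut:
  assumes "finite \<Lambda>"
  shows "(\<lambda>J. min_cut J x \<nu> \<Lambda>) \<in> borel_measurable (couplings \<rho>)"
  unfolding min_cut_def
proof (rule borel_measurable_cINF_real)
  show "countable (interfaces x \<nu> \<Lambda>)"
    using assms by (intro countable_finite finite_interfaces)
  fix I
  assume "I \<in> interfaces x \<nu> \<Lambda>"
  then show "(\<lambda>J. \<Sum>e\<in>I. J e) \<in> borel_measurable (couplings \<rho>)"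
    using edges_subset_UNIV[of \<Lambda>] by (intro borel_measurable_sum measurable_coupling) (auto simp: interfaces_def)
qed

lemma measurable_disconnection_prob:
  fixes \<Lambda> :: "'d::finite vertex set"
  assumes fin: "finite \<Lambda>" and q: "q \<ge> 1" and \<beta>: "\<beta> \<ge> 0"
  shows "(\<lambda>J. measure (rc_measure q \<beta> J (edges \<Lambda>) \<pi>) (disconnection x \<nu> \<Lambda>))
     \<in> borel_measurable (couplings \<rho>)"
proof -
  have weight: "(\<lambda>J. rc_weight q \<beta> J (edges \<Lambda>) \<pi> \<omega>) \<in> borel_measurable (couplings \<rho>)" for \<omega>
  proof -
    have "(\<lambda>J. if e \<in> \<omega> then open_prob \<beta> J e else 1 - open_prob \<beta> J e) \<in> borel_measurable (couplings \<rho>)"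
      if "e \<in> edges \<Lambda>" for e
    proof -
      have [measurable]: "(\<lambda>J. J e) \<in> borel_measurable (couplings \<rho>)"
        using that edges_subset_UNIV by (intro measurable_coupling) blast
      show ?thesis unfolding open_prob_def by measurable
    qed
    then show ?thesis
      unfolding rc_weight_def by (intro borel_measurable_times borel_measurable_prod borel_measurable_const)
  qed
  have "measure (rc_measure q \<beta> J (edges \<Lambda>) \<pi>) (disconnection x \<nu> \<Lambda>) =
     (\<Sum>\<omega>\<in>disconnection x \<nu> \<Lambda>. rc_weight q \<beta> J (edges \<Lambda>) \<pi> \<omega>) / rc_partition q \<beta> J (edges \<Lambda>) \<pi>"
    if J: "J \<in> space (couplings \<rho>)" for J
  proof (rule rc_measure_eq[OF q \<beta> finite_edges[OF fin] edges_subset_UNIV])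
    show "J e \<ge> 0" if "e \<in> edges \<Lambda>" for e
      using coupling_in_unit[OF J, of e] that edges_subset_UNIV[of \<Lambda>] by auto
  qed (auto simp: disconnection_def)
  note eq = this
  have "(\<lambda>J. (\<Sum>\<omega>\<in>disconnection x \<nu> \<Lambda>. rc_weight q \<beta> J (edges \<Lambda>) \<pi> \<omega>) /
      rc_partition q \<beta> J (edges \<Lambda>) \<pi>) \<in> borel_measurable (couplings \<rho>)"
    unfolding rc_partition_def by (intro borel_measurable_divide borel_measurable_sum weight)
  moreover have "(\<lambda>J. measure (rc_measure q \<beta> J (edges \<Lambda>) \<pi>) (disconnection x \<nu> \<Lambda>))
      \<in> borel_measurable (couplings \<rho>) \<longleftrightarrow>
      (\<lambda>J. (\<Sum>\<omega>\<in>disconnection x \<nu> \<Lambda>. rc_weight q \<beta> J (edges \<Lambda>) \<pi> \<omega>) /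
      rc_partition q \<beta> J (edges \<Lambda>) \<pi>) \<in> borel_measurable (couplings \<rho>)"
    by (rule measurable_cong) (rule eq)
  ultimately show ?thesis by (rule iffD2[rotated])
qed

text \<open>
  Only finitely many couplings occur, so the infinite product reduces to a finite one.
\<close>

lemma integral_coupling_prod:
  fixes I :: "'d::finite edge set" and f :: "real \<Rightarrow> real"
  assumes I: "finite I" "I \<subseteq> edges UNIV" and f: "integrable \<rho> f"
  shows "(\<integral>J. (\<Prod>e\<in>I. f (J e)) \<partial>couplings \<rho>) = (\<integral>x. f x \<partial>\<rho>) ^ card I"
    and "integrable (couplings \<rho>) (\<lambda>J. \<Prod>e\<in>I. f (J e))"
proof -
  interpret product_prob_space "\<lambda>_ :: 'd edge. \<rho>" "edges UNIV"
    by (intro product_prob_spaceI law(1))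
  have restrict: "distr (couplings \<rho>) (PiM I (\<lambda>_. \<rho>)) (\<lambda>J. restrict J I) = PiM I (\<lambda>_. \<rho>)"
    unfolding couplings_def using I by (rule distr_PiM_restrict_finite)
  have meas: "(\<lambda>J. restrict J I) \<in> measurable (couplings \<rho>) (PiM I (\<lambda>_. \<rho>))"
    unfolding couplings_def using I(2) by (rule measurable_restrict_subset)
  have int: "integrable (PiM I (\<lambda>_. \<rho>)) (\<lambda>J. \<Prod>e\<in>I. f (J e))"
    using I(1) f by (intro product_integrable_prod)
  have eq: "(\<Prod>e\<in>I. f (restrict J I e)) = (\<Prod>e\<in>I. f (J e))" for J
    by (intro prod.cong) auto
  have "(\<integral>J. (\<Prod>e\<in>I. f (J e)) \<partial>couplings \<rho>) = (\<integral>J. (\<Prod>e\<in>I. f (J e)) \<partial>PiM I (\<lambda>_. \<rho>))"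
    using integral_distr[OF meas borel_measurable_integrable[OF int]] unfolding restrict eq by simp
  also have "\<dots> = (\<Prod>e\<in>I. \<integral>x. f x \<partial>\<rho>)" using I(1) f by (rule product_integral_prod)
  finally show "(\<integral>J. (\<Prod>e\<in>I. f (J e)) \<partial>couplings \<rho>) = (\<integral>x. f x \<partial>\<rho>) ^ card I" by simp
  show "integrable (couplings \<rho>) (\<lambda>J. \<Prod>e\<in>I. f (J e))"
    using integrable_distr[OF meas, of "\<lambda>J. \<Prod>e\<in>I. f (J e)"] int unfolding restrict eq by simp
qed

lemma integrable_exp_law: "s \<ge> 0 \<Longrightarrow> integrable \<rho> (\<lambda>x. exp (- s * x))"
proof -
  interpret prob_space \<rho> by (rule law(1))
  assume "s \<ge> 0"
  then show ?thesis
    by (intro integrable_const_bound[where B = 1] AE_I2 measurable_law) (auto simp: space_law)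
qed

text \<open>
  Positivity is a statement about the law of a single coupling; it is read off at one fixed edge.
\<close>

lemma AE_law_positive:
  assumes pos: "\<And>e :: 'd::finite edge. e \<in> edges UNIV \<Longrightarrow> \<P>(J in couplings \<rho>. J e > 0) = 1"
  shows "AE x in \<rho>. x > 0"
proof -
  obtain i :: 'd where True by simp
  define e where "e = {0, 0 + axis i 1 :: 'd vertex}"
  have e: "e \<in> edges UNIV" by (simp only: e_def edges_iff adjacent_axis UNIV_I simp_thms)
  interpret C: prob_space "couplings \<rho> :: ('d edge \<Rightarrow> real) measure" by (rule prob_space_couplings)
  have meas: "(\<lambda>J. J e) \<in> measurable (couplings \<rho>) \<rho>"
    unfolding couplings_def using e by (rule measurable_component_singleton)
  have set: "{x \<in> space \<rho>. x > 0} \<in> sets \<rho>"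
    using measurable_law[of "\<lambda>x. x"] by (simp add: borel_measurable_iff_greater)
  have "AE J in couplings \<rho>. J \<in> {J \<in> space (couplings \<rho>). J e > 0}"
    by (rule C.AE_prob_1) (rule pos[OF e])
  then have "AE J in couplings \<rho>. J e > 0" by eventually_elim simp
  then have "AE x in distr (couplings \<rho>) \<rho> (\<lambda>J. J e). x > 0"
    by (subst AE_distr_iff[OF meas set])
  moreover have law_e: "distr (couplings \<rho>) \<rho> (\<lambda>J. J e) = \<rho>"
    unfolding couplings_def using law(1) e by (intro distr_PiM_component)
  ultimately show ?thesis unfolding law_e by simp
qed

text \<open>
  This is where positivity of the couplings enters: \<open>exp (- n x)\<close> tends to \<open>0\<close> for almost every \<open>x\<close>, dominated by \<open>1\<close>.
\<close>

lemma small_exponential_moment: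
  assumes pos: "AE x in \<rho>. x > 0" and c: "c > 0"
  obtains s :: real where "s \<ge> 0" "(\<integral>x. exp (- s * x) \<partial>\<rho>) \<le> c"
proof -
  interpret prob_space \<rho> by (rule law(1))
  have "(\<lambda>n. \<integral>x. exp (- real n * x) \<partial>\<rho>) \<longlonglongrightarrow> (\<integral>x. 0 \<partial>\<rho>)"
  proof (rule integral_dominated_convergence[where w = "\<lambda>_. 1"])
    show "AE x in \<rho>. (\<lambda>n. exp (- real n * x)) \<longlonglongrightarrow> 0"
      using pos
    proof eventually_elim
      fix x :: real
      assume "x > 0"
      then have "(\<lambda>n. exp (- x) ^ n) \<longlonglongrightarrow> 0" by (intro LIMSEQ_realpow_zero) auto
      then show "(\<lambda>n. exp (- real n * x)) \<longlonglongrightarrow> 0" by (simp add: exp_of_nat_mult[symmetric] mult.commute)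
    qed
    show "(\<lambda>x. exp (- real n * x)) \<in> borel_measurable \<rho>" for n
      by (rule measurable_law) measurable
    show "AE x in \<rho>. norm (exp (- real n * x)) \<le> 1" for n
      by (rule AE_I2) (auto simp: space_law)
  qed simp_all
  then have "\<forall>\<^sub>F n in sequentially. (\<integral>x. exp (- real n * x) \<partial>\<rho>) < c"
    using c by (intro order_tendstoD(2)) auto
  then obtain n where "(\<integral>x. exp (- real n * x) \<partial>\<rho>) < c"
    by (auto simp: eventually_sequentially)
  then show ?thesis using that[of "real n"] by simp
qed

end

section \<open>Limits in probability\<close>

text \<open>
  Pointwise inequalities that hold only on events of probability at least \<open>1/2\<close> still pass to limits in probability,
  because for large \<open>N\<close> the exceptional sets of \<open>X N\<close> and \<open>Y N\<close> together cannot cover \<open>A N\<close>.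
  Measurability is essential here, since a non-measurable exceptional set would have measure \<open>0\<close> by convention.
\<close>

lemma simultaneous_sample:
  assumes M: "prob_space M"
    and X: "converges_in_prob M X t" "\<And>N. N \<ge> 1 \<Longrightarrow> X N \<in> borel_measurable M"
    and Y: "converges_in_prob M Y m" "\<And>N. N \<ge> 1 \<Longrightarrow> Y N \<in> borel_measurable M"
    and A: "\<And>N. N \<ge> 1 \<Longrightarrow> A N \<in> sets M" "\<And>N. N \<ge> 1 \<Longrightarrow> measure M (A N) \<ge> 1/2"
    and \<epsilon>: "\<epsilon> > 0"
  obtains N \<omega> where "N \<ge> 1" "\<omega> \<in> A N" "\<omega> \<in> space M" "\<bar>X N \<omega> - t\<bar> \<le> \<epsilon>" "\<bar>Y N \<omega> - m\<bar> \<le> \<epsilon>"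
proof -
  interpret prob_space M by (rule M)
  have "\<forall>\<^sub>F N in sequentially. \<P>(\<omega> in M. \<bar>X N \<omega> - t\<bar> > \<epsilon>) < 1/4"
    using X(1) \<epsilon> unfolding converges_in_prob_def by (intro order_tendstoD(2)) auto
  moreover have "\<forall>\<^sub>F N in sequentially. \<P>(\<omega> in M. \<bar>Y N \<omega> - m\<bar> > \<epsilon>) < 1/4"
    using Y(1) \<epsilon> unfolding converges_in_prob_def by (intro order_tendstoD(2)) auto
  ultimately have "\<forall>\<^sub>F N in sequentially. \<P>(\<omega> in M. \<bar>X N \<omega> - t\<bar> > \<epsilon>) < 1/4 \<and>
      \<P>(\<omega> in M. \<bar>Y N \<omega> - m\<bar> > \<epsilon>) < 1/4 \<and> N \<ge> 1"
    using eventually_ge_at_top[of 1] by eventually_elim auto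
  then obtain N where N: "\<P>(\<omega> in M. \<bar>X N \<omega> - t\<bar> > \<epsilon>) < 1/4"
      "\<P>(\<omega> in M. \<bar>Y N \<omega> - m\<bar> > \<epsilon>) < 1/4" "N \<ge> 1"
    by (auto simp: eventually_sequentially)
  note [measurable] = X(2)[OF N(3)] Y(2)[OF N(3)]
  let ?BX = "{\<omega> \<in> space M. \<bar>X N \<omega> - t\<bar> > \<epsilon>}" and ?BY = "{\<omega> \<in> space M. \<bar>Y N \<omega> - m\<bar> > \<epsilon>}"
  have sets: "?BX \<in> sets M" "?BY \<in> sets M" by measurable
  have "\<not> A N \<subseteq> ?BX \<union> ?BY"
  proof
    assume "A N \<subseteq> ?BX \<union> ?BY"
    then have "measure M (A N) \<le> measure M (?BX \<union> ?BY)"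
      using sets by (intro finite_measure_mono) auto
    also have "\<dots> \<le> measure M ?BX + measure M ?BY" using sets by (rule measure_Un_le)
    finally show False using N(1,2) A(2)[OF N(3)] by simp
  qed
  then obtain \<omega> where "\<omega> \<in> A N" "\<omega> \<notin> ?BX" "\<omega> \<notin> ?BY" by blast
  moreover have "\<omega> \<in> space M" using \<open>\<omega> \<in> A N\<close> sets.sets_into_space[OF A(1)[OF N(3)]] by blast
  ultimately show ?thesis using that[of N \<omega>] N(3) by auto
qed

lemma converges_in_prob_unique:
  assumes M: "prob_space M" and X: "\<And>N. N \<ge> 1 \<Longrightarrow> X N \<in> borel_measurable M"
    and lim: "converges_in_prob M X t" "converges_in_prob M X t'"
  shows "t = t'"
proof (rule ccontr)
  assume "t \<noteq> t'"
  define \<epsilon> where "\<epsilon> = \<bar>t - t'\<bar> / 3"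
  have \<epsilon>: "\<epsilon> > 0" using \<open>t \<noteq> t'\<close> by (simp add: \<epsilon>_def)
  interpret prob_space M by (rule M)
  obtain N \<omega> where "\<bar>X N \<omega> - t\<bar> \<le> \<epsilon>" "\<bar>X N \<omega> - t'\<bar> \<le> \<epsilon>"
    by (rule simultaneous_sample[OF M lim(1) X lim(2) X _ _ \<epsilon>, where A = "\<lambda>_. space M"])
       (auto simp: prob_space)
  then have "\<bar>t - t'\<bar> \<le> 2 * \<epsilon>" by linarith
  then show False using \<epsilon> by (simp add: \<epsilon>_def)
qed

section \<open>Comparison of surface tension and maximal flow\<close>

lemma exit_edges_props:
  fixes \<Lambda> :: "'d::finite vertex set"
  shows "exit_edges x \<nu> \<Lambda> \<subseteq> edges UNIV" "e \<in> exit_edges x \<nu> \<Lambda> \<Longrightarrow> e \<inter> boundary \<Lambda> \<noteq> {}"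
    "edges \<Lambda> \<inter> exit_edges x \<nu> \<Lambda> = {}"
  by (auto simp: exit_edges_def edges_def upper_boundary_def doubleton_eq_iff)

lemma boundary_finite: "finite \<Lambda> \<Longrightarrow> finite (boundary \<Lambda>)"
  by (simp add: boundary_def)

text \<open>
  First moment bound for the sum left over by \<open>disconnection_upper_bound\<close>: each edge of \<open>I\<close> contributes a factor
  \<open>q E exp (- s J\<^sub>e)\<close>, which the choice of \<open>s\<close> makes smaller than the entropy per edge.
\<close>

lemma typical_cut_sum:
  fixes \<rho> :: "real measure" and \<Lambda> :: "'d::finite vertex set" and x \<nu> :: "real ^ 'd"
  assumes law: "prob_space \<rho>" "sets \<rho> = sets (restrict_space borel {0..1})"
    and deg: "\<And>e :: 'd edge. e \<noteq> {} \<Longrightarrow> finite {b. near e b} \<and> card {b. near e b} \<le> \<Delta>"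
    and fin: "finite \<Lambda>" and q: "q \<ge> 1"
    and s: "s \<ge> 0" "q * (\<integral>y. exp (- s * y) \<partial>\<rho>) \<le> (1/2) ^ (\<Delta> + 1)"
  defines "S \<equiv> (\<lambda>J. \<Sum>I | I \<subseteq> edges \<Lambda> \<and> rooted (exit_edges x \<nu> \<Lambda>) I. q ^ card I * exp (- s * (\<Sum>e\<in>I. J e)))"
  defines "A \<equiv> {J \<in> space (couplings \<rho>). S J < 2 * 2 ^ (\<Delta> * card (exit_edges x \<nu> \<Lambda>))}"
  shows "A \<in> sets (couplings \<rho>)" "measure (couplings \<rho>) A \<ge> 1/2"
proof -
  let ?F = "exit_edges x \<nu> \<Lambda>" and ?M = "couplings \<rho> :: ('d edge \<Rightarrow> real) measure"
  let ?FF = "{I. I \<subseteq> edges \<Lambda> \<and> rooted ?F I}" and ?T = "(2 :: real) ^ (\<Delta> * card ?F)"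
  let ?m = "\<integral>y. exp (- s * y) \<partial>\<rho>"
  interpret prob_space ?M by (rule prob_space_couplings[OF law])
  have finE: "finite (edges \<Lambda>)" by (rule finite_edges[OF fin])
  have finF: "finite ?F"
    by (rule edges_touching(1)[OF deg boundary_finite[OF fin] exit_edges_props(1,2)])
  have term_eq: "q ^ card I * exp (- s * (\<Sum>e\<in>I. J e)) = q ^ card I * (\<Prod>e\<in>I. exp (- s * J e))"
    if "I \<in> ?FF" for I and J :: "'d edge \<Rightarrow> real"
    using that finite_subset[OF _ finE] by (simp add: exp_sum sum_distrib_left flip: sum_negf)
  have S_eq: "S = (\<lambda>J. \<Sum>I\<in>?FF. q ^ card I * (\<Prod>e\<in>I. exp (- s * J e)))"
    unfolding S_def by (intro ext sum.cong refl term_eq)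
  have prods: "integrable ?M (\<lambda>J. \<Prod>e\<in>I. exp (- s * J e))"
    "(\<integral>J. (\<Prod>e\<in>I. exp (- s * J e)) \<partial>?M) = ?m ^ card I" if "I \<in> ?FF" for I
  proof -
    have I: "finite I" "I \<subseteq> edges UNIV"
      using that finite_subset[OF _ finE] edges_subset_UNIV[of \<Lambda>] by auto
    show "integrable ?M (\<lambda>J. \<Prod>e\<in>I. exp (- s * J e))"
      "(\<integral>J. (\<Prod>e\<in>I. exp (- s * J e)) \<partial>?M) = ?m ^ card I"
      by (rule integral_coupling_prod[OF law I integrable_exp_law[OF law s(1)]])+
  qed
  have int: "integrable ?M S"
    unfolding S_eq by (intro Bochner_Integration.integrable_sum integrable_mult_right prods(1)) auto
  have "(\<integral>J. S J \<partial>?M) = (\<Sum>I\<in>?FF. q ^ card I * ?m ^ card I)"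
    unfolding S_eq using prods by (subst Bochner_Integration.integral_sum) auto
  also have "\<dots> = (\<Sum>I\<in>?FF. (q * ?m) ^ card I)" by (simp add: power_mult_distrib)
  also have "\<dots> \<le> (\<Sum>I\<in>?FF. ((1/2) ^ (\<Delta> + 1)) ^ card I)"
    using s q by (intro sum_mono power_mono mult_nonneg_nonneg integral_nonneg) auto
  also have "\<dots> = (\<Sum>I\<in>?FF. (1/2) ^ ((\<Delta> + 1) * card I))" by (simp only: power_mult)
  also have "\<dots> \<le> ?T"
  proof (rule rooted_sets_entropy[OF finE finF exit_edges_props(3)])
    fix e
    assume "e \<in> edges \<Lambda> \<union> ?F"
    then have "e \<noteq> {}" by (auto simp: edges_def exit_edges_def)
    then show "finite {b. near e b} \<and> card {b. near e b} \<le> \<Delta>" by (rule deg)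
  qed
  finally have ES: "(\<integral>J. S J \<partial>?M) \<le> ?T" .
  have meas: "S \<in> borel_measurable ?M" using int by (rule borel_measurable_integrable)
  then show "A \<in> sets (couplings \<rho>)" unfolding A_def by measurable
  have "measure ?M {J \<in> space ?M. S J \<ge> 2 * ?T} \<le> (\<integral>J. S J \<partial>?M) / (2 * ?T)"
    using int q by (intro integral_Markov_inequality_measure[where A = "{}"]) (auto simp: S_def intro!: sum_nonneg)
  also have "\<dots> \<le> 1/2" using ES by (simp add: field_simps)
  finally have "prob {J \<in> space ?M. S J \<ge> 2 * ?T} \<le> 1/2" .
  moreover have "A = space ?M - {J \<in> space ?M. S J \<ge> 2 * ?T}" by (auto simp: A_def)
  moreover have "{J \<in> space ?M. S J \<ge> 2 * ?T} \<in> events" using meas by measurable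
  ultimately show "measure (couplings \<rho>) A \<ge> 1/2" by (simp add: prob_compl)
qed

lemma le_by_scaled_epsilon:
  fixes a b k :: real
  assumes "\<And>\<epsilon>. \<epsilon> > 0 \<Longrightarrow> a \<le> b + k * \<epsilon>" and "k \<ge> 0"
  shows "a \<le> b"
proof (rule field_le_epsilon)
  fix e :: real
  assume e: "e > 0"
  have "a \<le> b + k * (e / (k + 1))" using assms e by (intro assms(1)) auto
  also have "k * (e / (k + 1)) \<le> e" using assms(2) e by (simp add: field_simps)
  finally show "a \<le> b + e" by simp
qed

text \<open>
  Limits of the inequalities in a finite cube. Both constants are independent of \<open>\<beta>\<close> and \<open>\<nu>\<close>. Uniqueness of the limits
  identifies them with the values chosen by \<open>surface_tension\<close> and \<open>max_flow\<close>.
\<close>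

lemma tension_flow_comparison:
  fixes \<rho> :: "real measure" and \<nu> :: "real ^ 'd::finite"
  assumes d: "CARD('d) \<ge> 2" and q: "q \<ge> 1"
    and law: "prob_space \<rho>" "sets \<rho> = sets (restrict_space borel {0..1})"
    and deg: "\<And>e :: 'd edge. e \<noteq> {} \<Longrightarrow> finite {b. near e b} \<and> card {b. near e b} \<le> \<Delta>"
    and s: "s \<ge> 0" "q * (\<integral>y. exp (- s * y) \<partial>\<rho>) \<le> (1/2) ^ (\<Delta> + 1)"
    and \<beta>: "s \<le> \<beta>"
    and S: "S \<in> unit_cubes \<nu>"
    and t: "has_surface_tension \<rho> q \<beta> \<nu> t" and m: "has_max_flow \<rho> \<nu> m"
  defines "C \<equiv> 2 * real (CARD('d)) * (real (CARD('d)) + 1) ^ CARD('d)"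
  shows "t \<le> \<beta> * m" "(\<beta> - s) * m - (1 + real \<Delta> ^ 2 * C) \<le> t" "m \<le> \<Delta> * C"
    and "has_surface_tension \<rho> q \<beta> \<nu> t' \<Longrightarrow> t' = t" "has_max_flow \<rho> \<nu> m' \<Longrightarrow> m' = m"
proof -
  let ?M = "couplings \<rho> :: ('d edge \<Rightarrow> real) measure"
  define \<tau> where "\<tau> N J = rect_surface_tension q \<beta> J 0 (real N) (1/2 * real N) S \<nu>" for N J
  define \<mu> where "\<mu> N J = rect_max_flow J 0 (real N) (1/2 * real N) S \<nu>" for N J
  define \<Lambda> where "\<Lambda> N = lattice_part (rectangle 0 (real N) (1/2 * real N) S \<nu>)" for N
  define h where "h N = real N ^ (CARD('d) - 1)" for N
  define \<Phi> where "\<Phi> N J = measure (rc_measure q \<beta> J (edges (\<Lambda> N)) (wired (edges (\<Lambda> N)))) (disconnection 0 \<nu> (\<Lambda> N))" for N J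
  define \<Sigma> where "\<Sigma> N J = (\<Sum>I | I \<subseteq> edges (\<Lambda> N) \<and> rooted (exit_edges 0 \<nu> (\<Lambda> N)) I. q ^ card I * exp (- s * (\<Sum>e\<in>I. J e)))" for N J
  define A where "A N = {J \<in> space ?M. \<Sigma> N J < 2 * 2 ^ (\<Delta> * card (exit_edges 0 \<nu> (\<Lambda> N)))}" for N
  have \<tau>_eq: "\<tau> N J = - (1 / h N) * ln (\<Phi> N J)" for N J
    by (simp add: \<tau>_def rect_surface_tension_def Let_def \<Phi>_def \<Lambda>_def h_def)
  have \<mu>_eq: "\<mu> N J = (1 / h N) * min_cut J 0 \<nu> (\<Lambda> N)" for N J
    by (simp add: \<mu>_def rect_max_flow_def min_cut_def \<Lambda>_def h_def)
  have M: "prob_space ?M" by (rule prob_space_couplings[OF law])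
  have \<beta>0: "\<beta> \<ge> 0" using s \<beta> by simp
  have fin: "finite (\<Lambda> N)" if "N \<ge> 1" for N
    unfolding \<Lambda>_def using that by (intro lattice_finite S) simp
  have bd: "real (card (boundary (\<Lambda> N))) \<le> C * h N" if "N \<ge> 1" for N
    unfolding \<Lambda>_def C_def h_def using that by (intro lattice_boundary S) simp
  have J_unit: "0 \<le> J e" "J e \<le> 1" if "J \<in> space ?M" "e \<in> edges (\<Lambda> N)" for J e N
    using coupling_in_unit[OF law that(1), of e] that(2) edges_subset_UNIV[of "\<Lambda> N"] by auto
  have h: "h N \<ge> 1" if "N \<ge> 1" for N using that by (simp add: h_def)
  have upper: "\<tau> N J \<le> \<beta> * \<mu> N J" and
    lower: "J \<in> A N \<Longrightarrow> (\<beta> - s) * \<mu> N J - (1 + real \<Delta> ^ 2 * C) \<le> \<tau> N J" and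
    flow: "\<mu> N J \<le> \<Delta> * C" if N: "N \<ge> 1" and J: "J \<in> space ?M" for N J
  proof -
    let ?c = "min_cut J 0 \<nu> (\<Lambda> N)"
    have h0: "h N > 0" using h[OF N] by simp
    have "exp (- \<beta> * ?c) \<le> \<Phi> N J"
      unfolding \<Phi>_def by (rule disconnection_lower_bound[OF fin[OF N] J_unit(1)[OF J] q \<beta>0])
    then have \<Phi>: "\<Phi> N J > 0" "- \<beta> * ?c \<le> ln (\<Phi> N J)"
      by (auto simp: less_le_trans[OF exp_gt_zero] ln_ge_iff)
    then show "\<tau> N J \<le> \<beta> * \<mu> N J" using h0 by (simp add: \<tau>_eq \<mu>_eq field_simps)
    have "?c \<le> (\<Sum>e | e \<in> edges (\<Lambda> N) \<and> e \<inter> upper_boundary 0 \<nu> (\<Lambda> N) \<noteq> {}. J e)"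
      by (rule min_cut_le[OF fin[OF N] J_unit(1)[OF J] _ separating_upper_star]) auto
    also have "\<dots> \<le> (\<Sum>e | e \<in> edges (\<Lambda> N) \<and> e \<inter> upper_boundary 0 \<nu> (\<Lambda> N) \<noteq> {}. 1)"
      using J_unit(2)[OF J] by (intro sum_mono) auto
    also have "\<dots> = real (card {e \<in> edges (\<Lambda> N). e \<inter> upper_boundary 0 \<nu> (\<Lambda> N) \<noteq> {}})" by simp
    also have "\<dots> \<le> real (\<Delta> * card (boundary (\<Lambda> N)))"
      using edges_subset_UNIV[of "\<Lambda> N"]
      by (intro of_nat_mono edges_touching(2)[OF deg boundary_finite[OF fin[OF N]]])
         (auto simp: upper_boundary_def)
    also have "\<dots> \<le> \<Delta> * (C * h N)" using bd[OF N] by (simp add: mult_left_mono)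
    finally show "\<mu> N J \<le> \<Delta> * C" using h0 by (simp add: \<mu>_eq field_simps)
    assume JA: "J \<in> A N"
    let ?F = "exit_edges 0 \<nu> (\<Lambda> N)"
    have "\<Phi> N J \<le> exp (- (\<beta> - s) * ?c) * \<Sigma> N J"
      unfolding \<Phi>_def \<Sigma>_def
    proof (rule disconnection_upper_bound[OF fin[OF N] J_unit(1)[OF J] d _ _ q s(1) \<beta>])
      show "\<bar>y $ i\<bar> \<le> \<lfloor>CARD('d) * real N / 2\<rfloor>" if "y \<in> \<Lambda> N" for y i
        using that N unfolding \<Lambda>_def by (intro lattice_bounded[OF S]) auto
      show "ray_escapes (\<Lambda> N)" unfolding \<Lambda>_def using N by (intro lattice_ray_escapes[OF S]) simp
    qed
    also have "\<dots> \<le> exp (- (\<beta> - s) * ?c) * (2 * 2 ^ (\<Delta> * card ?F))"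
      using JA by (intro mult_left_mono) (auto simp: A_def)
    finally have "ln (\<Phi> N J) \<le> ln (exp (- (\<beta> - s) * ?c) * (2 * 2 ^ (\<Delta> * card ?F)))"
      using \<Phi>(1) by (intro ln_mono) auto
    also have "\<dots> = - (\<beta> - s) * ?c + (1 + real (\<Delta> * card ?F)) * ln 2"
      by (simp add: ln_mult ln_realpow algebra_simps)
    also have "(1 + real (\<Delta> * card ?F)) * ln 2 \<le> (1 + real (\<Delta> * card ?F)) * 1"
      using ln_2_less_1 by (intro mult_left_mono) auto
    also have "real (\<Delta> * card ?F) \<le> \<Delta> * (\<Delta> * (C * h N))"
    proof -
      have "real (card ?F) \<le> real (\<Delta> * card (boundary (\<Lambda> N)))"
        by (intro of_nat_mono edges_touching(2)[OF deg boundary_finite[OF fin[OF N]]] exit_edges_props)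
      also have "\<dots> \<le> \<Delta> * (C * h N)" using bd[OF N] by (simp add: mult_left_mono)
      finally show ?thesis by (simp add: mult_left_mono)
    qed
    finally have "ln (\<Phi> N J) \<le> - (\<beta> - s) * ?c + (1 + \<Delta> * (\<Delta> * (C * h N)))" by simp
    also have "\<dots> \<le> - (\<beta> - s) * ?c + (1 + real \<Delta> ^ 2 * C) * h N"
      using h[OF N] by (simp add: algebra_simps power2_eq_square)
    finally have "(1 / h N) * ln (\<Phi> N J) \<le>
        (1 / h N) * (- (\<beta> - s) * ?c + (1 + real \<Delta> ^ 2 * C) * h N)"
      using h0 by (intro mult_left_mono) auto
    also have "\<dots> = - ((\<beta> - s) * \<mu> N J) + (1 + real \<Delta> ^ 2 * C)"
      using h0 by (simp add: \<mu>_eq field_simps)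
    finally show "(\<beta> - s) * \<mu> N J - (1 + real \<Delta> ^ 2 * C) \<le> \<tau> N J"
      by (simp add: \<tau>_eq)
  qed
  have \<tau>_meas: "\<tau> N \<in> borel_measurable ?M" if "N \<ge> 1" for N
    unfolding \<tau>_eq \<Phi>_def
    by (intro borel_measurable_times borel_measurable_const borel_measurable_ln
        measurable_disconnection_prob[OF law fin[OF that] q \<beta>0])
  have \<mu>_meas: "\<mu> N \<in> borel_measurable ?M" if "N \<ge> 1" for N
    unfolding \<mu>_eq
    by (intro borel_measurable_times borel_measurable_const measurable_min_cut[OF law fin[OF that]])
  have t_lim: "converges_in_prob ?M \<tau> t" if "has_surface_tension \<rho> q \<beta> \<nu> t" for t
    using that S unfolding has_surface_tension_def \<tau>_def by (elim allE[of _ "1/2"]) auto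
  have m_lim: "converges_in_prob ?M \<mu> m" if "has_max_flow \<rho> \<nu> m" for m
    using that S unfolding has_max_flow_def \<mu>_def by (elim allE[of _ "1/2"]) auto
  show "has_surface_tension \<rho> q \<beta> \<nu> t' \<Longrightarrow> t' = t"
    by (rule converges_in_prob_unique[OF M \<tau>_meas t_lim t_lim[OF t]])
  show "has_max_flow \<rho> \<nu> m' \<Longrightarrow> m' = m"
    by (rule converges_in_prob_unique[OF M \<mu>_meas m_lim m_lim[OF m]])
  have approx: "t \<le> \<beta> * m + (\<beta> + 1) * \<epsilon> \<and> (\<beta> - s) * m - (1 + real \<Delta> ^ 2 * C) \<le> t + (\<beta> + 1) * \<epsilon> \<and>
      m \<le> \<Delta> * C + 1 * \<epsilon>" if \<epsilon>: "\<epsilon> > 0" for \<epsilon>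
  proof -
    have A1: "A N \<in> sets ?M" if "N \<ge> 1" for N
      unfolding A_def \<Sigma>_def by (rule typical_cut_sum(1)[OF law deg fin[OF that] q s])
    have A2: "measure ?M (A N) \<ge> 1/2" if "N \<ge> 1" for N
      unfolding A_def \<Sigma>_def by (rule typical_cut_sum(2)[OF law deg fin[OF that] q s])
    obtain N J where NJ: "N \<ge> 1" "J \<in> A N" "J \<in> space ?M"
      and close: "\<bar>\<tau> N J - t\<bar> \<le> \<epsilon>" "\<bar>\<mu> N J - m\<bar> \<le> \<epsilon>"
      by (rule simultaneous_sample[OF M t_lim[OF t] \<tau>_meas m_lim[OF m] \<mu>_meas A1 A2 \<epsilon>])
    have "\<beta> * \<mu> N J \<le> \<beta> * (m + \<epsilon>)" using close(2) \<beta>0 by (intro mult_left_mono) linarith+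
    moreover have "(\<beta> - s) * (m - \<epsilon>) \<le> (\<beta> - s) * \<mu> N J"
      using close(2) \<beta> by (intro mult_left_mono) linarith+
    moreover have "0 \<le> s * \<epsilon>" using s \<epsilon> by simp
    ultimately show ?thesis
      using upper[OF NJ(1,3)] lower[OF NJ(1,3,2)] flow[OF NJ(1,3)] close
      by (simp add: algebra_simps abs_le_iff)
  qed
  have k: "\<beta> + 1 \<ge> 0" using \<beta>0 by simp
  show "t \<le> \<beta> * m"
    by (rule le_by_scaled_epsilon[OF conjunct1[OF approx] k])
  show "(\<beta> - s) * m - (1 + real \<Delta> ^ 2 * C) \<le> t"
    by (rule le_by_scaled_epsilon[OF conjunct1[OF conjunct2[OF approx]] k])
  show "m \<le> \<Delta> * C"
    by (rule le_by_scaled_epsilon[OF conjunct2[OF conjunct2[OF approx]] zero_le_one])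
qed

theorem proposition1p11:
  fixes \<rho> :: "real measure" and q :: real
  assumes dim: "CARD('d::finite) \<ge> 2"
    and q: "q \<ge> 1"
    and law: "prob_space \<rho>" "sets \<rho> = sets (restrict_space borel {0..1})"
    and pos: "\<And>e :: 'd edge. e \<in> edges UNIV \<Longrightarrow> \<P>(J in couplings \<rho>. J e > 0) = 1"
    and surface_tension_exists:
      "\<And>(\<beta> :: real) (\<nu> :: real ^ 'd). \<beta> \<ge> 0 \<Longrightarrow> norm \<nu> = 1 \<Longrightarrow> \<exists>t. has_surface_tension \<rho> q \<beta> \<nu> t"
    and max_flow_exists:
      "\<And>\<nu> :: real ^ 'd. norm \<nu> = 1 \<Longrightarrow> \<exists>m. has_max_flow \<rho> \<nu> m"
  shows "uniform_limit (sphere (0 :: real ^ 'd) 1)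
           (\<lambda>\<beta> \<nu>. surface_tension \<rho> q \<beta> \<nu> / \<beta>) (\<lambda>\<nu>. max_flow \<rho> \<nu>) at_top"
proof -
  obtain \<Delta> where deg: "\<And>e :: 'd edge. e \<noteq> {} \<Longrightarrow> finite {b. near e b} \<and> card {b. near e b} \<le> \<Delta>"
    using near_degree_bound[where 'd = 'd] by auto
  have "(1/2) ^ (\<Delta> + 1) / q > 0" using q by simp
  from small_exponential_moment[OF law AE_law_positive[OF law pos] this]
  obtain s where s: "s \<ge> 0" "(\<integral>y. exp (- s * y) \<partial>\<rho>) \<le> (1/2) ^ (\<Delta> + 1) / q" .
  then have sq: "q * (\<integral>y. exp (- s * y) \<partial>\<rho>) \<le> (1/2) ^ (\<Delta> + 1)" using q by (simp add: field_simps)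
  define C where "C = 2 * real (CARD('d)) * (real (CARD('d)) + 1) ^ CARD('d)"
  \<comment> \<open>the bound \<open>\<Delta> * C\<close> on the flow makes the loss \<open>s * m\<close> uniform in the direction\<close>
  define K where "K = s * (\<Delta> * C) + (1 + real \<Delta> ^ 2 * C)"
  have main: "dist (surface_tension \<rho> q \<beta> \<nu> / \<beta>) (max_flow \<rho> \<nu>) \<le> K / \<beta>"
    if \<nu>: "norm \<nu> = 1" and \<beta>: "\<beta> \<ge> s" "\<beta> > 0" for \<beta> and \<nu> :: "real ^ 'd"
  proof -
    obtain S where S: "S \<in> unit_cubes \<nu>" using unit_cubes_nonempty[OF \<nu>] by blast
    obtain t where t: "has_surface_tension \<rho> q \<beta> \<nu> t" using surface_tension_exists[OF _ \<nu>] \<beta> by force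
    obtain m where m: "has_max_flow \<rho> \<nu> m" using max_flow_exists[OF \<nu>] by blast
    note comparison = tension_flow_comparison[OF dim q law deg s(1) sq \<beta>(1) S t m, folded C_def]
    have T: "surface_tension \<rho> q \<beta> \<nu> = t"
      unfolding surface_tension_def using t comparison(4) by (rule the_equality)
    have F: "max_flow \<rho> \<nu> = m"
      unfolding max_flow_def using m comparison(5) by (rule the_equality)
    have "s * m \<le> s * (\<Delta> * C)" using comparison(3) s(1) by (rule mult_left_mono)
    then have "\<beta> * m - K \<le> t" using comparison(2) by (simp add: K_def algebra_simps)
    then have "(\<beta> * m - K) / \<beta> \<le> t / \<beta>" using \<beta>(2) by (intro divide_right_mono) auto
    then have "m - K / \<beta> \<le> t / \<beta>" using \<beta>(2) by (simp add: diff_divide_distrib)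
    moreover have "t / \<beta> \<le> m" using comparison(1) \<beta>(2) by (simp add: field_simps)
    ultimately show ?thesis by (simp add: T F dist_real_def)
  qed
  show ?thesis
  proof (rule uniform_limitI)
    fix e :: real
    assume e: "e > 0"
    have "\<forall>\<^sub>F \<beta> in at_top. \<beta> > max (max s 0) (K / e)" by (rule eventually_gt_at_top)
    then show "\<forall>\<^sub>F \<beta> in at_top. \<forall>\<nu>\<in>sphere (0 :: real ^ 'd) 1.
        dist (surface_tension \<rho> q \<beta> \<nu> / \<beta>) (max_flow \<rho> \<nu>) < e"
    proof eventually_elim
      case (elim \<beta>)
      then have "K / \<beta> < e" using e by (simp add: field_simps)
      show ?case
      proof
        fix \<nu> :: "real ^ 'd"
        assume "\<nu> \<in> sphere 0 1"
        then have "dist (surface_tension \<rho> q \<beta> \<nu> / \<beta>) (max_flow \<rho> \<nu>) \<le> K / \<beta>"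
          using elim by (intro main) auto
        also note \<open>K / \<beta> < e\<close>
        finally show "dist (surface_tension \<rho> q \<beta> \<nu> / \<beta>) (max_flow \<rho> \<nu>) < e" .
      qed
    qed
  qed
qed

end
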